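(* Fix a structural dominance $\operatorname{D}$ and let $\operatorname{d}(X):=\lVert\operatorname{D}(X)\rVert$. If countable choice holds, then for any $f:\mathbb N\to\mathcal L(\mathbb N)$, $f$ is $\operatorname{D}$-disciplined if and only if $\operatorname{d}(\operatorname{defined}(f(n)))$ holds for all $n:\mathbb N$. In particular, countable choice implies that $f:\mathbb N\to\mathcal L(\mathbb N)$ is Rosolini-disciplined (i.e. $\operatorname{D}=\operatorname{rosoliniStructure}$) if and only if $f$ factors through a Rosolini partial function, i.e. $f=i\circ g$ for some $g:\mathbb N\to\mathcal L_{\operatorname{isRosolini}}(\mathbb N)$, where $i$ is the canonical inclusion.
   Context: Type theory: Martin-Löf type theory with universe $\mathcal U$, function extensionality, proposition extensionality and propositional truncations. $\mathcal L(Y):=\sum_{P:\mathcal U}\operatorname{isProp}(P)\times(P\to Y)$ with components $\operatorname{defined}$, $\operatorname{value}$. A structural dominance is $\operatorname{D}:\mathcal U\to\mathcal U$ with maps $\operatorname{D}(X)\to\operatorname{isProp}(X)$, an element of $\operatorname{D}(1)$, and closure $\operatorname{D}(P)\to(\prod_{p:P}\operatorname{D}(Q(p)))\to\operatorname{D}(\sum_{p:P}Q(p))$ for $Q:P\to\mathcal U$. $\mathcal L_{\operatorname{D}}(Y):=\sum_{P:\mathcal U}\operatorname{D}(P)\times(P\to Y)$; $\operatorname{tame}(f'):=e\circ f'$ where $e(P,d,\varphi)=(P,-,\varphi)$; $f$ is $\operatorname{D}$-disciplined if $\lVert\sum_{f':X\to\mathcal L_{\operatorname{D}}(Y)}\operatorname{tame}(f')=f\rVert$.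 For $\alpha:\mathbb N\to2$, $\langle\alpha\rangle:=\sum_n(\alpha_n=1)$; $\mathbb N_\infty:=\sum_\alpha\operatorname{isProp}\langle\alpha\rangle$; $\operatorname{rosoliniStructure}(P):=\sum_{u:\mathbb N_\infty}(P=\langle u\rangle)$ (a structural dominance); $\operatorname{isRosolini}(P):=\lVert\operatorname{rosoliniStructure}(P)\rVert$; $\mathcal L_{\operatorname{isRosolini}}(Y):=\sum_{P}\operatorname{isRosolini}(P)\times(P\to Y)$ with inclusion $i(P,r,\varphi)=(P,-,\varphi)$ into $\mathcal L(Y)$. Countable choice: for every $Y:\mathbb N\to\mathcal U$, $(\prod_n\lVert Y(n)\rVert)\to\lVert\prod_n Y(n)\rVert$. *)

theory Defs
  imports Main
begin

text \<open>
  The object theory is intensional Martin-Loef type theory with a cumulative hierarchy of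
  Russell universes, presented by the three judgements of the appendix of the HoTT book
  (contexts, typing, typed judgemental equality), extended by function extensionality,
  propositional extensionality and propositional truncations. There is no separate judgement
  for types: \<open>A\<close> is a type in context \<open>\<Gamma>\<close> when \<open>\<Gamma> \<turnstile> A : U i\<close> for some level \<open>i\<close>.

  Terms use de Bruijn indices. Only the second arguments of \<open>Pi\<close> and \<open>Sig\<close> and the argument of
  \<open>Lam\<close> are binding positions. The motive of an eliminator is a function into a universe.
  Binary sums are not primitive; they are definable from \<open>Sig\<close> and \<open>Two\<close>.
\<close>

datatype tm =
    Var nat
  | U nat
  | Pi tm tm | Lam tm | App tm tm
  | Sig tm tm | Pr tm tm | Pr1 tm | Pr2 tm
  | Id tm tm tm | Refl tm | J tm tm tm
  | Empty | EmptyInd tm tm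
  | Unit | Star | UnitInd tm tm tm
  | Two | Two0 | Two1 | TwoInd tm tm tm tm
  | Nat | Zero | Succ tm | NatInd tm tm tm tm
  | Trunc tm | TruncIn nat | TruncProp nat | TruncRec nat nat
  | FunExt nat | PropExt nat

text \<open>\<open>lift n k t\<close> adds \<open>n\<close> to every variable of \<open>t\<close> that is free above the first \<open>k\<close>.\<close>

primrec lift :: "nat \<Rightarrow> nat \<Rightarrow> tm \<Rightarrow> tm" where
  "lift n k (Var m) = Var (if m < k then m else m + n)"
| "lift n k (U i) = U i"
| "lift n k (Pi A B) = Pi (lift n k A) (lift n (Suc k) B)"
| "lift n k (Lam t) = Lam (lift n (Suc k) t)"
| "lift n k (App t u) = App (lift n k t) (lift n k u)"
| "lift n k (Sig A B) = Sig (lift n k A) (lift n (Suc k) B)"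
| "lift n k (Pr t u) = Pr (lift n k t) (lift n k u)"
| "lift n k (Pr1 t) = Pr1 (lift n k t)"
| "lift n k (Pr2 t) = Pr2 (lift n k t)"
| "lift n k (Id A t u) = Id (lift n k A) (lift n k t) (lift n k u)"
| "lift n k (Refl t) = Refl (lift n k t)"
| "lift n k (J C d p) = J (lift n k C) (lift n k d) (lift n k p)"
| "lift n k Empty = Empty"
| "lift n k (EmptyInd C t) = EmptyInd (lift n k C) (lift n k t)"
| "lift n k Unit = Unit"
| "lift n k Star = Star"
| "lift n k (UnitInd C c t) = UnitInd (lift n k C) (lift n k c) (lift n k t)"
| "lift n k Two = Two"
| "lift n k Two0 = Two0"
| "lift n k Two1 = Two1"
| "lift n k (TwoInd C c d t) = TwoInd (lift n k C) (lift n k c) (lift n k d) (lift n k t)"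
| "lift n k Nat = Nat"
| "lift n k Zero = Zero"
| "lift n k (Succ t) = Succ (lift n k t)"
| "lift n k (NatInd C z s t) = NatInd (lift n k C) (lift n k z) (lift n k s) (lift n k t)"
| "lift n k (Trunc A) = Trunc (lift n k A)"
| "lift n k (TruncIn i) = TruncIn i"
| "lift n k (TruncProp i) = TruncProp i"
| "lift n k (TruncRec i j) = TruncRec i j"
| "lift n k (FunExt i) = FunExt i"
| "lift n k (PropExt i) = PropExt i"

abbreviation weaken :: "tm \<Rightarrow> nat \<Rightarrow> tm" (infixl "\<up>" 95) where
  "t \<up> n \<equiv> lift n 0 t"

primrec subst :: "nat \<Rightarrow> tm \<Rightarrow> tm \<Rightarrow> tm" where
  "subst k s (Var m) = (if m < k then Var m else if m = k then s \<up> k else Var (m - 1))"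
| "subst k s (U i) = U i"
| "subst k s (Pi A B) = Pi (subst k s A) (subst (Suc k) s B)"
| "subst k s (Lam t) = Lam (subst (Suc k) s t)"
| "subst k s (App t u) = App (subst k s t) (subst k s u)"
| "subst k s (Sig A B) = Sig (subst k s A) (subst (Suc k) s B)"
| "subst k s (Pr t u) = Pr (subst k s t) (subst k s u)"
| "subst k s (Pr1 t) = Pr1 (subst k s t)"
| "subst k s (Pr2 t) = Pr2 (subst k s t)"
| "subst k s (Id A t u) = Id (subst k s A) (subst k s t) (subst k s u)"
| "subst k s (Refl t) = Refl (subst k s t)"
| "subst k s (J C d p) = J (subst k s C) (subst k s d) (subst k s p)"
| "subst k s Empty = Empty"
| "subst k s (EmptyInd C t) = EmptyInd (subst k s C) (subst k s t)"
| "subst k s Unit = Unit"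
| "subst k s Star = Star"
| "subst k s (UnitInd C c t) = UnitInd (subst k s C) (subst k s c) (subst k s t)"
| "subst k s Two = Two"
| "subst k s Two0 = Two0"
| "subst k s Two1 = Two1"
| "subst k s (TwoInd C c d t) = TwoInd (subst k s C) (subst k s c) (subst k s d) (subst k s t)"
| "subst k s Nat = Nat"
| "subst k s Zero = Zero"
| "subst k s (Succ t) = Succ (subst k s t)"
| "subst k s (NatInd C z f t) = NatInd (subst k s C) (subst k s z) (subst k s f) (subst k s t)"
| "subst k s (Trunc A) = Trunc (subst k s A)"
| "subst k s (TruncIn i) = TruncIn i"
| "subst k s (TruncProp i) = TruncProp i"
| "subst k s (TruncRec i j) = TruncRec i j"
| "subst k s (FunExt i) = FunExt i"
| "subst k s (PropExt i) = PropExt i"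

abbreviation inst :: "tm \<Rightarrow> tm \<Rightarrow> tm" where
  "inst t s \<equiv> subst 0 s t"

abbreviation App2 :: "tm \<Rightarrow> tm \<Rightarrow> tm \<Rightarrow> tm" where
  "App2 f a b \<equiv> App (App f a) b"

definition Arr :: "tm \<Rightarrow> tm \<Rightarrow> tm" (infixr "\<rightarrowtriangle>" 70) where
  "A \<rightarrowtriangle> B = Pi A (B \<up> 1)"

definition Prod :: "tm \<Rightarrow> tm \<Rightarrow> tm" (infixr "\<otimes>" 75) where
  "A \<otimes> B = Sig A (B \<up> 1)"

definition Iff :: "tm \<Rightarrow> tm \<Rightarrow> tm" (infix "\<leftrightharpoons>" 65) where
  "A \<leftrightharpoons> B = (A \<rightarrowtriangle> B) \<otimes> (B \<rightarrowtriangle> A)"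

definition isProp :: "tm \<Rightarrow> tm" where
  "isProp A = Pi A (Pi (A \<up> 1) (Id (A \<up> 2) (Var 1) (Var 0)))"

text \<open>
  The types of the constants that are added to Martin-Loef type theory. The truncation of a type
  is in the universe of that type, and recursion out of it is into propositions of any universe,
  without a judgemental computation rule.
\<close>

definition TruncIn_type :: "nat \<Rightarrow> tm" where
  "TruncIn_type i = Pi (U i) (Var 0 \<rightarrowtriangle> Trunc (Var 0))"

definition TruncProp_type :: "nat \<Rightarrow> tm" where
  "TruncProp_type i = Pi (U i) (isProp (Trunc (Var 0)))"

definition TruncRec_type :: "nat \<Rightarrow> nat \<Rightarrow> tm" where
  "TruncRec_type i j =
     Pi (U i) (Pi (U j)
       (isProp (Var 0) \<rightarrowtriangle> (Var 1 \<rightarrowtriangle> Var 0) \<rightarrowtriangle> Trunc (Var 1) \<rightarrowtriangle> Var 0))"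

definition FunExt_type :: "nat \<Rightarrow> tm" where
  "FunExt_type i =
     Pi (U i) (Pi (Var 0 \<rightarrowtriangle> U i)
       (let F = Pi (Var 1) (App (Var 1) (Var 0)) in
        Pi F (Pi (F \<up> 1)
          (Pi (Var 3) (Id (App (Var 3) (Var 0)) (App (Var 2) (Var 0)) (App (Var 1) (Var 0)))
            \<rightarrowtriangle> Id (F \<up> 2) (Var 1) (Var 0)))))"

definition PropExt_type :: "nat \<Rightarrow> tm" where
  "PropExt_type i =
     Pi (U i) (Pi (U i)
       (isProp (Var 1) \<rightarrowtriangle> isProp (Var 0) \<rightarrowtriangle> (Var 1 \<rightarrowtriangle> Var 0) \<rightarrowtriangle> (Var 0 \<rightarrowtriangle> Var 1)
         \<rightarrowtriangle> Id (U i) (Var 1) (Var 0)))"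

inductive
  ctx :: "tm list \<Rightarrow> bool" and
  typing :: "tm list \<Rightarrow> tm \<Rightarrow> tm \<Rightarrow> bool" ("_ \<turnstile> _ : _" [50, 50, 50] 50) and
  equal :: "tm list \<Rightarrow> tm \<Rightarrow> tm \<Rightarrow> tm \<Rightarrow> bool" ("_ \<turnstile> _ \<equiv> _ : _" [50, 50, 50, 50] 50)
where
  ctx_nil: "ctx []"
| ctx_cons: "\<Gamma> \<turnstile> A : U i \<Longrightarrow> ctx (A # \<Gamma>)"

| var: "ctx \<Gamma> \<Longrightarrow> n < length \<Gamma> \<Longrightarrow> \<Gamma> \<turnstile> Var n : (\<Gamma> ! n) \<up> Suc n"
| conv: "\<Gamma> \<turnstile> t : A \<Longrightarrow> \<Gamma> \<turnstile> A \<equiv> B : U i \<Longrightarrow> \<Gamma> \<turnstile> t : B"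
| univ: "ctx \<Gamma> \<Longrightarrow> \<Gamma> \<turnstile> U i : U (Suc i)"
| cumul: "\<Gamma> \<turnstile> A : U i \<Longrightarrow> \<Gamma> \<turnstile> A : U (Suc i)"

| eq_refl: "\<Gamma> \<turnstile> t : A \<Longrightarrow> \<Gamma> \<turnstile> t \<equiv> t : A"
| eq_sym: "\<Gamma> \<turnstile> t \<equiv> u : A \<Longrightarrow> \<Gamma> \<turnstile> u \<equiv> t : A"
| eq_trans: "\<Gamma> \<turnstile> t \<equiv> u : A \<Longrightarrow> \<Gamma> \<turnstile> u \<equiv> v : A \<Longrightarrow> \<Gamma> \<turnstile> t \<equiv> v : A"
| eq_conv: "\<Gamma> \<turnstile> t \<equiv> u : A \<Longrightarrow> \<Gamma> \<turnstile> A \<equiv> B : U i \<Longrightarrow> \<Gamma> \<turnstile> t \<equiv> u : B"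
| eq_cumul: "\<Gamma> \<turnstile> A \<equiv> B : U i \<Longrightarrow> \<Gamma> \<turnstile> A \<equiv> B : U (Suc i)"

| Pi_form: "\<Gamma> \<turnstile> A : U i \<Longrightarrow> A # \<Gamma> \<turnstile> B : U i \<Longrightarrow> \<Gamma> \<turnstile> Pi A B : U i"
| Pi_intro: "A # \<Gamma> \<turnstile> t : B \<Longrightarrow> \<Gamma> \<turnstile> Lam t : Pi A B"
| Pi_elim: "\<Gamma> \<turnstile> f : Pi A B \<Longrightarrow> \<Gamma> \<turnstile> a : A \<Longrightarrow> \<Gamma> \<turnstile> App f a : inst B a"
| Pi_beta: "A # \<Gamma> \<turnstile> t : B \<Longrightarrow> \<Gamma> \<turnstile> a : A \<Longrightarrow> \<Gamma> \<turnstile> App (Lam t) a \<equiv> inst t a : inst B a"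
| Pi_eta: "\<Gamma> \<turnstile> f : Pi A B \<Longrightarrow> \<Gamma> \<turnstile> f \<equiv> Lam (App (f \<up> 1) (Var 0)) : Pi A B"
| Pi_cong: "\<Gamma> \<turnstile> A \<equiv> A' : U i \<Longrightarrow> A # \<Gamma> \<turnstile> B \<equiv> B' : U i \<Longrightarrow> \<Gamma> \<turnstile> Pi A B \<equiv> Pi A' B' : U i"
| Lam_cong: "A # \<Gamma> \<turnstile> t \<equiv> t' : B \<Longrightarrow> \<Gamma> \<turnstile> Lam t \<equiv> Lam t' : Pi A B"
| App_cong: "\<Gamma> \<turnstile> f \<equiv> f' : Pi A B \<Longrightarrow> \<Gamma> \<turnstile> a \<equiv> a' : A \<Longrightarrow> \<Gamma> \<turnstile> App f a \<equiv> App f' a' : inst B a"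

| Sig_form: "\<Gamma> \<turnstile> A : U i \<Longrightarrow> A # \<Gamma> \<turnstile> B : U i \<Longrightarrow> \<Gamma> \<turnstile> Sig A B : U i"
| Sig_intro: "\<Gamma> \<turnstile> a : A \<Longrightarrow> A # \<Gamma> \<turnstile> B : U i \<Longrightarrow> \<Gamma> \<turnstile> b : inst B a \<Longrightarrow> \<Gamma> \<turnstile> Pr a b : Sig A B"
| Sig_elim1: "\<Gamma> \<turnstile> p : Sig A B \<Longrightarrow> \<Gamma> \<turnstile> Pr1 p : A"
| Sig_elim2: "\<Gamma> \<turnstile> p : Sig A B \<Longrightarrow> \<Gamma> \<turnstile> Pr2 p : inst B (Pr1 p)"
| Sig_beta1: "\<Gamma> \<turnstile> a : A \<Longrightarrow> A # \<Gamma> \<turnstile> B : U i \<Longrightarrow> \<Gamma> \<turnstile> b : inst B a \<Longrightarrow> \<Gamma> \<turnstile> Pr1 (Pr a b) \<equiv> a : A"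
| Sig_beta2: "\<Gamma> \<turnstile> a : A \<Longrightarrow> A # \<Gamma> \<turnstile> B : U i \<Longrightarrow> \<Gamma> \<turnstile> b : inst B a \<Longrightarrow>
    \<Gamma> \<turnstile> Pr2 (Pr a b) \<equiv> b : inst B a"
| Sig_eta: "\<Gamma> \<turnstile> p : Sig A B \<Longrightarrow> \<Gamma> \<turnstile> p \<equiv> Pr (Pr1 p) (Pr2 p) : Sig A B"
| Sig_cong: "\<Gamma> \<turnstile> A \<equiv> A' : U i \<Longrightarrow> A # \<Gamma> \<turnstile> B \<equiv> B' : U i \<Longrightarrow> \<Gamma> \<turnstile> Sig A B \<equiv> Sig A' B' : U i"
| Pr_cong: "\<Gamma> \<turnstile> a \<equiv> a' : A \<Longrightarrow> A # \<Gamma> \<turnstile> B : U i \<Longrightarrow> \<Gamma> \<turnstile> b \<equiv> b' : inst B a \<Longrightarrow>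
    \<Gamma> \<turnstile> Pr a b \<equiv> Pr a' b' : Sig A B"
| Pr1_cong: "\<Gamma> \<turnstile> p \<equiv> p' : Sig A B \<Longrightarrow> \<Gamma> \<turnstile> Pr1 p \<equiv> Pr1 p' : A"
| Pr2_cong: "\<Gamma> \<turnstile> p \<equiv> p' : Sig A B \<Longrightarrow> \<Gamma> \<turnstile> Pr2 p \<equiv> Pr2 p' : inst B (Pr1 p)"

| Id_form: "\<Gamma> \<turnstile> A : U i \<Longrightarrow> \<Gamma> \<turnstile> a : A \<Longrightarrow> \<Gamma> \<turnstile> b : A \<Longrightarrow> \<Gamma> \<turnstile> Id A a b : U i"
| Id_intro: "\<Gamma> \<turnstile> a : A \<Longrightarrow> \<Gamma> \<turnstile> Refl a : Id A a a"
| Id_elim: "\<Gamma> \<turnstile> C : Pi A (Pi (Id (A \<up> 1) (a \<up> 1) (Var 0)) (U i)) \<Longrightarrow>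
    \<Gamma> \<turnstile> d : App2 C a (Refl a) \<Longrightarrow> \<Gamma> \<turnstile> p : Id A a b \<Longrightarrow> \<Gamma> \<turnstile> J C d p : App2 C b p"
| Id_beta: "\<Gamma> \<turnstile> C : Pi A (Pi (Id (A \<up> 1) (a \<up> 1) (Var 0)) (U i)) \<Longrightarrow>
    \<Gamma> \<turnstile> a : A \<Longrightarrow> \<Gamma> \<turnstile> d : App2 C a (Refl a) \<Longrightarrow> \<Gamma> \<turnstile> J C d (Refl a) \<equiv> d : App2 C a (Refl a)"
| Id_cong: "\<Gamma> \<turnstile> A \<equiv> A' : U i \<Longrightarrow> \<Gamma> \<turnstile> a \<equiv> a' : A \<Longrightarrow> \<Gamma> \<turnstile> b \<equiv> b' : A \<Longrightarrow>
    \<Gamma> \<turnstile> Id A a b \<equiv> Id A' a' b' : U i"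
| Refl_cong: "\<Gamma> \<turnstile> a \<equiv> a' : A \<Longrightarrow> \<Gamma> \<turnstile> Refl a \<equiv> Refl a' : Id A a a"
| J_cong: "\<Gamma> \<turnstile> C \<equiv> C' : Pi A (Pi (Id (A \<up> 1) (a \<up> 1) (Var 0)) (U i)) \<Longrightarrow>
    \<Gamma> \<turnstile> d \<equiv> d' : App2 C a (Refl a) \<Longrightarrow> \<Gamma> \<turnstile> p \<equiv> p' : Id A a b \<Longrightarrow>
    \<Gamma> \<turnstile> J C d p \<equiv> J C' d' p' : App2 C b p"

| Empty_form: "ctx \<Gamma> \<Longrightarrow> \<Gamma> \<turnstile> Empty : U 0"
| Empty_elim: "\<Gamma> \<turnstile> C : Empty \<rightarrowtriangle> U i \<Longrightarrow> \<Gamma> \<turnstile> t : Empty \<Longrightarrow> \<Gamma> \<turnstile> EmptyInd C t : App C t"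
| EmptyInd_cong: "\<Gamma> \<turnstile> C \<equiv> C' : Empty \<rightarrowtriangle> U i \<Longrightarrow> \<Gamma> \<turnstile> t \<equiv> t' : Empty \<Longrightarrow>
    \<Gamma> \<turnstile> EmptyInd C t \<equiv> EmptyInd C' t' : App C t"

| Unit_form: "ctx \<Gamma> \<Longrightarrow> \<Gamma> \<turnstile> Unit : U 0"
| Unit_intro: "ctx \<Gamma> \<Longrightarrow> \<Gamma> \<turnstile> Star : Unit"
| Unit_elim: "\<Gamma> \<turnstile> C : Unit \<rightarrowtriangle> U i \<Longrightarrow> \<Gamma> \<turnstile> c : App C Star \<Longrightarrow> \<Gamma> \<turnstile> t : Unit \<Longrightarrow>
    \<Gamma> \<turnstile> UnitInd C c t : App C t"
| Unit_beta: "\<Gamma> \<turnstile> C : Unit \<rightarrowtriangle> U i \<Longrightarrow> \<Gamma> \<turnstile> c : App C Star \<Longrightarrow>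
    \<Gamma> \<turnstile> UnitInd C c Star \<equiv> c : App C Star"
| UnitInd_cong: "\<Gamma> \<turnstile> C \<equiv> C' : Unit \<rightarrowtriangle> U i \<Longrightarrow> \<Gamma> \<turnstile> c \<equiv> c' : App C Star \<Longrightarrow>
    \<Gamma> \<turnstile> t \<equiv> t' : Unit \<Longrightarrow> \<Gamma> \<turnstile> UnitInd C c t \<equiv> UnitInd C' c' t' : App C t"

| Two_form: "ctx \<Gamma> \<Longrightarrow> \<Gamma> \<turnstile> Two : U 0"
| Two_intro0: "ctx \<Gamma> \<Longrightarrow> \<Gamma> \<turnstile> Two0 : Two"
| Two_intro1: "ctx \<Gamma> \<Longrightarrow> \<Gamma> \<turnstile> Two1 : Two"
| Two_elim: "\<Gamma> \<turnstile> C : Two \<rightarrowtriangle> U i \<Longrightarrow> \<Gamma> \<turnstile> c : App C Two0 \<Longrightarrow> \<Gamma> \<turnstile> d : App C Two1 \<Longrightarrow>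
    \<Gamma> \<turnstile> t : Two \<Longrightarrow> \<Gamma> \<turnstile> TwoInd C c d t : App C t"
| Two_beta0: "\<Gamma> \<turnstile> C : Two \<rightarrowtriangle> U i \<Longrightarrow> \<Gamma> \<turnstile> c : App C Two0 \<Longrightarrow> \<Gamma> \<turnstile> d : App C Two1 \<Longrightarrow>
    \<Gamma> \<turnstile> TwoInd C c d Two0 \<equiv> c : App C Two0"
| Two_beta1: "\<Gamma> \<turnstile> C : Two \<rightarrowtriangle> U i \<Longrightarrow> \<Gamma> \<turnstile> c : App C Two0 \<Longrightarrow> \<Gamma> \<turnstile> d : App C Two1 \<Longrightarrow>
    \<Gamma> \<turnstile> TwoInd C c d Two1 \<equiv> d : App C Two1"
| TwoInd_cong: "\<Gamma> \<turnstile> C \<equiv> C' : Two \<rightarrowtriangle> U i \<Longrightarrow> \<Gamma> \<turnstile> c \<equiv> c' : App C Two0 \<Longrightarrow>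
    \<Gamma> \<turnstile> d \<equiv> d' : App C Two1 \<Longrightarrow> \<Gamma> \<turnstile> t \<equiv> t' : Two \<Longrightarrow>
    \<Gamma> \<turnstile> TwoInd C c d t \<equiv> TwoInd C' c' d' t' : App C t"

| Nat_form: "ctx \<Gamma> \<Longrightarrow> \<Gamma> \<turnstile> Nat : U 0"
| Nat_intro0: "ctx \<Gamma> \<Longrightarrow> \<Gamma> \<turnstile> Zero : Nat"
| Nat_introS: "\<Gamma> \<turnstile> n : Nat \<Longrightarrow> \<Gamma> \<turnstile> Succ n : Nat"
| Nat_elim: "\<Gamma> \<turnstile> C : Nat \<rightarrowtriangle> U i \<Longrightarrow> \<Gamma> \<turnstile> z : App C Zero \<Longrightarrow>
    \<Gamma> \<turnstile> s : Pi Nat (App (C \<up> 1) (Var 0) \<rightarrowtriangle> App (C \<up> 1) (Succ (Var 0))) \<Longrightarrow> \<Gamma> \<turnstile> n : Nat \<Longrightarrow>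
    \<Gamma> \<turnstile> NatInd C z s n : App C n"
| Nat_beta0: "\<Gamma> \<turnstile> C : Nat \<rightarrowtriangle> U i \<Longrightarrow> \<Gamma> \<turnstile> z : App C Zero \<Longrightarrow>
    \<Gamma> \<turnstile> s : Pi Nat (App (C \<up> 1) (Var 0) \<rightarrowtriangle> App (C \<up> 1) (Succ (Var 0))) \<Longrightarrow>
    \<Gamma> \<turnstile> NatInd C z s Zero \<equiv> z : App C Zero"
| Nat_betaS: "\<Gamma> \<turnstile> C : Nat \<rightarrowtriangle> U i \<Longrightarrow> \<Gamma> \<turnstile> z : App C Zero \<Longrightarrow>
    \<Gamma> \<turnstile> s : Pi Nat (App (C \<up> 1) (Var 0) \<rightarrowtriangle> App (C \<up> 1) (Succ (Var 0))) \<Longrightarrow> \<Gamma> \<turnstile> n : Nat \<Longrightarrow>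
    \<Gamma> \<turnstile> NatInd C z s (Succ n) \<equiv> App2 s n (NatInd C z s n) : App C (Succ n)"
| Succ_cong: "\<Gamma> \<turnstile> n \<equiv> n' : Nat \<Longrightarrow> \<Gamma> \<turnstile> Succ n \<equiv> Succ n' : Nat"
| NatInd_cong: "\<Gamma> \<turnstile> C \<equiv> C' : Nat \<rightarrowtriangle> U i \<Longrightarrow> \<Gamma> \<turnstile> z \<equiv> z' : App C Zero \<Longrightarrow>
    \<Gamma> \<turnstile> s \<equiv> s' : Pi Nat (App (C \<up> 1) (Var 0) \<rightarrowtriangle> App (C \<up> 1) (Succ (Var 0))) \<Longrightarrow>
    \<Gamma> \<turnstile> n \<equiv> n' : Nat \<Longrightarrow> \<Gamma> \<turnstile> NatInd C z s n \<equiv> NatInd C' z' s' n' : App C n"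

| Trunc_form: "\<Gamma> \<turnstile> A : U i \<Longrightarrow> \<Gamma> \<turnstile> Trunc A : U i"
| Trunc_cong: "\<Gamma> \<turnstile> A \<equiv> A' : U i \<Longrightarrow> \<Gamma> \<turnstile> Trunc A \<equiv> Trunc A' : U i"
| TruncIn: "ctx \<Gamma> \<Longrightarrow> \<Gamma> \<turnstile> TruncIn i : TruncIn_type i"
| TruncProp: "ctx \<Gamma> \<Longrightarrow> \<Gamma> \<turnstile> TruncProp i : TruncProp_type i"
| TruncRec: "ctx \<Gamma> \<Longrightarrow> \<Gamma> \<turnstile> TruncRec i j : TruncRec_type i j"
| FunExt: "ctx \<Gamma> \<Longrightarrow> \<Gamma> \<turnstile> FunExt i : FunExt_type i"
| PropExt: "ctx \<Gamma> \<Longrightarrow> \<Gamma> \<turnstile> PropExt i : PropExt_type i"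

text \<open>
  \<open>Lift i Y\<close> is the lifting of \<open>Y\<close> with extents in \<open>U i\<close>; \<open>LiftD i D Y\<close> takes the operation \<open>D\<close> as a
  term. A term \<open>m\<close> of type \<open>Pi (U i) (App (D \<up> 1) (Var 0) \<rightarrowtriangle> isProp (Var 0))\<close> induces the map
  \<open>forget m\<close> from \<open>LiftD i D Y\<close> to \<open>Lift i Y\<close>, and \<open>tame m f\<close> is its composite with \<open>f\<close>. For the first
  component \<open>m\<close> of a structural dominance, \<open>forget m\<close> is the map \<open>e\<close>; for \<open>D = isRosolini i\<close> and
  \<open>m = isRosolini_isProp i\<close> it is the canonical inclusion.
\<close>

definition Lift :: "nat \<Rightarrow> tm \<Rightarrow> tm" where
  "Lift i Y = Sig (U i) (isProp (Var 0) \<otimes> (Var 0 \<rightarrowtriangle> Y \<up> 1))"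

definition defined :: "tm \<Rightarrow> tm" where
  "defined l = Pr1 l"

definition LiftD :: "nat \<Rightarrow> tm \<Rightarrow> tm \<Rightarrow> tm" where
  "LiftD i D Y = Sig (U i) (App (D \<up> 1) (Var 0) \<otimes> (Var 0 \<rightarrowtriangle> Y \<up> 1))"

definition forget :: "tm \<Rightarrow> tm \<Rightarrow> tm" where
  "forget m l = Pr (Pr1 l) (Pr (App2 m (Pr1 l) (Pr1 (Pr2 l))) (Pr2 (Pr2 l)))"

definition tame :: "tm \<Rightarrow> tm \<Rightarrow> tm" where
  "tame m f = Lam (forget (m \<up> 1) (App (f \<up> 1) (Var 0)))"

text \<open>
  The operation \<open>D\<close> is allowed to take values in a universe other than that of its arguments,
  because \<open>rosoliniStructure\<close> maps \<open>U i\<close> to \<open>U (Suc i)\<close>.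
\<close>

definition structural_dominance :: "nat \<Rightarrow> tm \<Rightarrow> tm" where
  "structural_dominance i D =
     Pi (U i) (App (D \<up> 1) (Var 0) \<rightarrowtriangle> isProp (Var 0))
     \<otimes> App D Unit
     \<otimes> Pi (U i) (Pi (Var 0 \<rightarrowtriangle> U i)
         (App (D \<up> 2) (Var 1)
           \<rightarrowtriangle> Pi (Var 1) (App (D \<up> 3) (App (Var 1) (Var 0)))
           \<rightarrowtriangle> App (D \<up> 2) (Sig (Var 1) (App (Var 1) (Var 0)))))"

definition disciplined :: "nat \<Rightarrow> tm \<Rightarrow> tm \<Rightarrow> tm \<Rightarrow> tm \<Rightarrow> tm \<Rightarrow> tm" where
  "disciplined i D m X Y f =
     Trunc (Sig (X \<rightarrowtriangle> LiftD i D Y)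
       (Id ((X \<rightarrowtriangle> Lift i Y) \<up> 1) (tame (m \<up> 1) (Var 0)) (f \<up> 1)))"

definition countable_choice :: "nat \<Rightarrow> tm" where
  "countable_choice i =
     Pi (Nat \<rightarrowtriangle> U i)
       (Pi Nat (Trunc (App (Var 1) (Var 0))) \<rightarrowtriangle> Trunc (Pi Nat (App (Var 1) (Var 0))))"

text \<open>The Rosolini propositions.\<close>

definition angle :: "tm \<Rightarrow> tm" where
  "angle \<alpha> = Sig Nat (Id Two (App (\<alpha> \<up> 1) (Var 0)) Two1)"

definition Nat_inf :: tm where
  "Nat_inf = Sig (Nat \<rightarrowtriangle> Two) (isProp (angle (Var 0)))"

definition rosoliniStructure :: "nat \<Rightarrow> tm" where
  "rosoliniStructure i = Lam (Sig Nat_inf (Id (U i) (Var 1) (angle (Pr1 (Var 0)))))"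

definition isRosolini :: "nat \<Rightarrow> tm" where
  "isRosolini i = Lam (Trunc (App (rosoliniStructure i) (Var 0)))"

text \<open>
  The remaining terms witness that types with Rosolini structure, and Rosolini types, are
  propositions. The latter needs the fact that being a proposition is a proposition.
  With \<open>p : Id X x y\<close> and \<open>q : Id X y z\<close>, the types of the path operations are
  \<open>path_sym X x p : Id X y x\<close>, \<open>path_trans X x p q : Id X x z\<close> and
  \<open>path_sym_trans X x p : Id (Id X y y) (Refl y) (path_trans X y (path_sym X x p) p)\<close>.
  With \<open>h : isProp X\<close> and \<open>p, q : Id X x y\<close>, \<open>prop_path X h x p\<close> identifies \<open>p\<close> with a path that
  does not mention \<open>p\<close>, and hence \<open>prop_set X h x y p q : Id (Id X x y) p q\<close>.
\<close>

definition path_sym :: "tm \<Rightarrow> tm \<Rightarrow> tm \<Rightarrow> tm" where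
  "path_sym X x p = J (Lam (Lam (Id (X \<up> 2) (Var 1) (x \<up> 2)))) (Refl x) p"

definition path_trans :: "tm \<Rightarrow> tm \<Rightarrow> tm \<Rightarrow> tm \<Rightarrow> tm" where
  "path_trans X x p q = J (Lam (Lam (Id (X \<up> 2) (x \<up> 2) (Var 1)))) p q"

definition path_sym_trans :: "tm \<Rightarrow> tm \<Rightarrow> tm \<Rightarrow> tm" where
  "path_sym_trans X x p =
     J (Lam (Lam (Id (Id (X \<up> 2) (Var 1) (Var 1)) (Refl (Var 1))
         (path_trans (X \<up> 2) (Var 1) (path_sym (X \<up> 2) (x \<up> 2) (Var 0)) (Var 0)))))
       (Refl (Refl x)) p"

definition prop_path :: "tm \<Rightarrow> tm \<Rightarrow> tm \<Rightarrow> tm \<Rightarrow> tm" where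
  "prop_path X h x p =
     J (Lam (Lam (Id (Id (X \<up> 2) (x \<up> 2) (Var 1)) (Var 0)
         (path_trans (X \<up> 2) (x \<up> 2)
           (path_sym (X \<up> 2) (x \<up> 2) (App2 (h \<up> 2) (x \<up> 2) (x \<up> 2)))
           (App2 (h \<up> 2) (x \<up> 2) (Var 1))))))
       (path_sym_trans X x (App2 h x x)) p"

definition prop_set :: "tm \<Rightarrow> tm \<Rightarrow> tm \<Rightarrow> tm \<Rightarrow> tm \<Rightarrow> tm \<Rightarrow> tm" where
  "prop_set X h x y p q =
     path_trans (Id X x y) p (prop_path X h x p)
       (path_sym (Id X x y) q (prop_path X h x q))"

abbreviation funext :: "nat \<Rightarrow> tm \<Rightarrow> tm \<Rightarrow> tm \<Rightarrow> tm \<Rightarrow> tm \<Rightarrow> tm" where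
  "funext i A B f g h \<equiv> App (App2 (App2 (FunExt i) A B) f g) h"

definition isProp_isProp :: "nat \<Rightarrow> tm \<Rightarrow> tm" where
  "isProp_isProp i X =
     Lam (Lam (funext i (X \<up> 2) (Lam (Pi (X \<up> 3) (Id (X \<up> 4) (Var 1) (Var 0)))) (Var 1) (Var 0)
       (Lam (funext i (X \<up> 3) (Lam (Id (X \<up> 4) (Var 1) (Var 0)))
               (App (Var 2) (Var 0)) (App (Var 1) (Var 0))
         (Lam (prop_set (X \<up> 4) (Var 3) (Var 1) (Var 0)
                (App2 (Var 3) (Var 1) (Var 0)) (App2 (Var 2) (Var 1) (Var 0))))))))"

definition rosoliniStructure_isProp :: tm where
  "rosoliniStructure_isProp =
     Lam (Lam (App (J (Lam (Lam (isProp (Var 1) \<rightarrowtriangle> isProp (Var 3)))) (Lam (Var 0)) (Pr2 (Var 0)))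
       (Pr2 (Pr1 (Var 0)))))"

definition isRosolini_isProp :: "nat \<Rightarrow> tm" where
  "isRosolini_isProp i =
     Lam (Lam (App (App2 (App2 (TruncRec (Suc i) i) (App (rosoliniStructure i) (Var 1))
         (isProp (Var 1))) (isProp_isProp i (Var 1)) (App (rosoliniStructure_isProp) (Var 1)))
       (Var 0)))"

definition factors_through_Rosolini :: "nat \<Rightarrow> tm \<Rightarrow> tm \<Rightarrow> tm \<Rightarrow> tm" where
  "factors_through_Rosolini i X Y f =
     Sig (X \<rightarrowtriangle> LiftD i (isRosolini i) Y)
       (Id ((X \<rightarrowtriangle> Lift i Y) \<up> 1) (f \<up> 1) (tame (isRosolini_isProp i) (Var 0)))"

end

theory Submission
  imports Defs
begin

text \<open>
  If \<open>tame f' = f\<close>, path induction turns the \<open>D\<close>-structure on the extents of \<open>f'\<close> into one on the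
  extents of \<open>f\<close>. Conversely, given \<open>D\<close>-structure on every extent of \<open>f\<close>, replacing the proofs of
  propositionhood in the values of \<open>f\<close> by this structure gives an \<open>f'\<close>; by function extensionality
  \<open>tame f' = f\<close>, since being a proposition is a proposition. Both passages are untruncated, so
  the first half follows by truncation recursion, and countable choice is used only to
  move the truncation out of the product over the natural numbers. The Rosolini half
  applies the same two passages to \<open>rosoliniStructure\<close> and to its truncation \<open>isRosolini\<close>.
\<close>

section \<open>Weakening and substitution\<close>

text \<open>Everything is an inhabitation claim in a deeply embedded theory, so each step is a
  typing derivation. Terms that the statement itself mentions, such as \<open>prop_set\<close> and
  \<open>isRosolini_isProp\<close>, are typed as they stand; for most other constructions it is
  enough that some term exists.

  Two obstacles shape the argument. The first is universe levels: choice for \<open>U j\<close>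
  suits a \<open>D\<close> with values in \<open>U j\<close>, but \<open>rosoliniStructure i\<close>
  has values in \<open>U (Suc i)\<close> while the second half assumes choice only for
  \<open>U i\<close>. It is therefore not an instance of the first half and passes through a small
  reformulation of Rosolini structure. The second is truncation: \<open>disciplined\<close> is
  truncated and \<open>factors_through_Rosolini\<close> is not, so a factorisation has to come out
  of mere existence. It does, because being Rosolini at every point is a product of truncations,
  hence a proposition into which the truncation can be eliminated, and from it a factorisation can
  be written down.\<close>

lemma lift_0 [simp]: "lift 0 k t = t"
  by (induction t arbitrary: k) auto

lemma lift_lift_add [simp]:
  "k \<le> j \<Longrightarrow> j \<le> k + m \<Longrightarrow> lift n j (lift m k t) = lift (n + m) k t"
  by (induction t arbitrary: j k) auto

lemma lift_lift_comm: "k \<le> j \<Longrightarrow> lift n (j + m) (lift m k t) = lift m k (lift n j t)"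
proof (induction t arbitrary: j k)
  case (Pi A B) from Pi.IH(1)[OF Pi.prems] Pi.IH(2)[of "Suc k" "Suc j"] Pi.prems show ?case by simp
next
  case (Sig A B) from Sig.IH(1)[OF Sig.prems] Sig.IH(2)[of "Suc k" "Suc j"] Sig.prems show ?case by simp
next
  case (Lam t) from Lam.IH[of "Suc k" "Suc j"] Lam.prems show ?case by simp
qed auto

lemma subst_lift [simp]:
  "j \<le> k \<Longrightarrow> k < j + n \<Longrightarrow> subst k s (lift n j t) = lift (n - 1) j t"
  by (induction t arbitrary: j k) auto

lemma subst_lift_ge: "j \<le> k \<Longrightarrow> subst (k + n) s (lift n j t) = lift n j (subst k s t)"
proof (induction t arbitrary: j k)
  case (Pi A B) from Pi.IH(1)[OF Pi.prems] Pi.IH(2)[of "Suc j" "Suc k"] Pi.prems show ?case by simp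
next
  case (Sig A B) from Sig.IH(1)[OF Sig.prems] Sig.IH(2)[of "Suc j" "Suc k"] Sig.prems show ?case by simp
next
  case (Lam t) from Lam.IH[of "Suc j" "Suc k"] Lam.prems show ?case by simp
qed (auto simp: add.commute)

lemma lift_subst: "lift n (k + j) (subst k s t) = subst k (lift n j s) (lift n (Suc (k + j)) t)"
proof (induction t arbitrary: k)
  case (Var m)
  show ?case using lift_lift_comm[of 0 j n k s] by (auto simp: add.commute)
next
  case (Pi A B) from Pi.IH(1)[of k] Pi.IH(2)[of "Suc k"] show ?case by simp
next
  case (Sig A B) from Sig.IH(1)[of k] Sig.IH(2)[of "Suc k"] show ?case by simp
next
  case (Lam t) from Lam.IH[of "Suc k"] show ?case by simp
qed auto

lemma subst_subst: "subst (k + j) s (subst k u t) = subst k (subst j s u) (subst (Suc (k + j)) s t)"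
proof (induction t arbitrary: k)
  case (Var m)
  show ?case using subst_lift_ge[of 0 j k s u] by (auto simp: add.commute)
next
  case (Pi A B) from Pi.IH(1)[of k] Pi.IH(2)[of "Suc k"] show ?case by simp
next
  case (Sig A B) from Sig.IH(1)[of k] Sig.IH(2)[of "Suc k"] show ?case by simp
next
  case (Lam t) from Lam.IH[of "Suc k"] show ?case by simp
qed auto

text \<open>The cutoff is written with subtraction so that the simplifier can match any
  \<open>j\<close>. Weakenings at cutoff \<open>0\<close> move outwards, which is the normal form in
  the later index computations.\<close>

lemma lift_lift_comm0 [simp]: "m \<le> j \<Longrightarrow> lift n j (lift m 0 t) = lift m 0 (lift n (j - m) t)"
  using lift_lift_comm[of 0 "j - m" n m t] by simp

lemma subst_lift0_ge [simp]: "n \<le> k \<Longrightarrow> subst k s (lift n 0 t) = lift n 0 (subst (k - n) s t)"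
  using subst_lift_ge[of 0 "k - n" n s t] by simp

lemma lift_inst: "lift n k (inst t s) = inst (lift n (Suc k) t) (lift n k s)"
  using lift_subst[of n 0 k s t] by simp

lemma subst_inst: "subst k s (inst t u) = inst (subst (Suc k) s t) (subst k s u)"
  using subst_subst[of 0 k s u t] by simp

text \<open>Index computation behind every \<open>App (f \<up> Suc 0) (Var 0)\<close>: the weakened
  codomain of \<open>f\<close>, instantiated at the fresh variable, is the original
  codomain.\<close>

lemma inst_lift_Var [simp]: "subst k (Var 0) (lift (Suc 0) (Suc k) t) = t"
  by (induction t arbitrary: k) auto

lemmas const_type_defs =
  TruncIn_type_def TruncProp_type_def TruncRec_type_def FunExt_type_def PropExt_type_def

lemma lift_Arr [simp]: "lift n k (A \<rightarrowtriangle> B) = lift n k A \<rightarrowtriangle> lift n k B"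
  using lift_lift_comm[of 0 k n 1 B] by (simp add: Arr_def)

lemma lift_Prod [simp]: "lift n k (A \<otimes> B) = lift n k A \<otimes> lift n k B"
  using lift_lift_comm[of 0 k n 1 B] by (simp add: Prod_def)

lemma lift_Iff [simp]: "lift n k (A \<leftrightharpoons> B) = (lift n k A \<leftrightharpoons> lift n k B)"
  by (simp add: Iff_def)

lemma lift_isProp [simp]: "lift n k (isProp A) = isProp (lift n k A)"
  using lift_lift_comm[of 0 k n 1 A] lift_lift_comm[of 0 k n 2 A] by (simp add: isProp_def numeral_2_eq_2)

lemma subst_Arr [simp]: "subst k s (A \<rightarrowtriangle> B) = subst k s A \<rightarrowtriangle> subst k s B"
  using subst_lift_ge[of 0 k 1 s B] by (simp add: Arr_def)

lemma subst_Prod [simp]: "subst k s (A \<otimes> B) = subst k s A \<otimes> subst k s B"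
  using subst_lift_ge[of 0 k 1 s B] by (simp add: Prod_def)

lemma subst_isProp [simp]: "subst k s (isProp A) = isProp (subst k s A)"
  using subst_lift_ge[of 0 k 1 s A] subst_lift_ge[of 0 k 2 s A] by (simp add: isProp_def numeral_2_eq_2)

text \<open>The types of the added constants are closed, so the rules for these constants survive
  weakening, and likewise substitution, verbatim.\<close>

lemma lift_const_types [simp]:
  "lift n k (TruncIn_type i) = TruncIn_type i"
  "lift n k (TruncProp_type i) = TruncProp_type i"
  "lift n k (TruncRec_type i j) = TruncRec_type i j"
  "lift n k (FunExt_type i) = FunExt_type i"
  "lift n k (PropExt_type i) = PropExt_type i"
  by (simp_all add: const_type_defs Let_def)

lemma subst_const_types [simp]:
  "subst k s (TruncIn_type i) = TruncIn_type i"
  "subst k s (TruncProp_type i) = TruncProp_type i"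
  "subst k s (TruncRec_type i j) = TruncRec_type i j"
  "subst k s (FunExt_type i) = FunExt_type i"
  "subst k s (PropExt_type i) = PropExt_type i"
  by (simp_all add: const_type_defs Let_def)

text \<open>\<open>lift_ctx\<close> and \<open>subst_ctx\<close> act on a context that extends the one being weakened or
  substituted into: an entry with \<open>k\<close> entries of the extension below it is lifted above \<open>k\<close>.\<close>

primrec lift_ctx :: "nat \<Rightarrow> tm list \<Rightarrow> tm list" where
  "lift_ctx n [] = []"
| "lift_ctx n (A # \<Gamma>) = lift n (length \<Gamma>) A # lift_ctx n \<Gamma>"

primrec subst_ctx :: "tm \<Rightarrow> tm list \<Rightarrow> tm list" where
  "subst_ctx s [] = []"
| "subst_ctx s (A # \<Gamma>) = subst (length \<Gamma>) s A # subst_ctx s \<Gamma>"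

section \<open>Admissibility of weakening and substitution\<close>

lemma length_lift_ctx [simp]: "length (lift_ctx n \<Gamma>) = length \<Gamma>"
  by (induction \<Gamma>) auto

lemma length_subst_ctx [simp]: "length (subst_ctx n \<Gamma>) = length \<Gamma>"
  by (induction \<Gamma>) auto

lemma nth_lift_ctx: "m < length \<Gamma> \<Longrightarrow> lift_ctx n \<Gamma> ! m = lift n (length \<Gamma> - Suc m) (\<Gamma> ! m)"
  by (induction \<Gamma> arbitrary: m) (auto simp: nth_Cons split: nat.split)

lemma nth_subst_ctx: "m < length \<Gamma> \<Longrightarrow> subst_ctx s \<Gamma> ! m = subst (length \<Gamma> - Suc m) s (\<Gamma> ! m)"
  by (induction \<Gamma> arbitrary: m) (auto simp: nth_Cons split: nat.split)

text \<open>Rules such as \<open>Pi_intro\<close> mention the context of their conclusion only as a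
  tail in the premise. Claiming all tails makes the induction hypothesis at \<open>Suc k\<close>
  skip the bound entry, so no inversion of \<open>ctx\<close> is needed.\<close>

lemma typing_ctx_drop:
  "ctx \<Gamma> \<Longrightarrow> ctx (drop k \<Gamma>)"
  "\<Gamma> \<turnstile> t : A \<Longrightarrow> ctx (drop k \<Gamma>)"
  "\<Gamma> \<turnstile> t \<equiv> u : A \<Longrightarrow> ctx (drop k \<Gamma>)"
proof (induction arbitrary: k and k and k rule: ctx_typing_equal.inducts)
  case (ctx_cons \<Gamma> A i k) then show ?case by (cases k) (auto intro: ctx_typing_equal.intros)
qed (simp_all add: ctx_nil, (metis drop_Suc_Cons)+)

lemma typing_ctx: "\<Gamma> \<turnstile> t : A \<Longrightarrow> ctx \<Gamma>" "\<Gamma> \<turnstile> t \<equiv> u : A \<Longrightarrow> ctx \<Gamma>"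
  using typing_ctx_drop[where k = 0] by auto

lemma lift_var:
  assumes "ctx (lift_ctx (length \<Delta>) \<Theta> @ \<Delta> @ \<Xi>)" and "n < length (\<Theta> @ \<Xi>)"
  shows "lift_ctx (length \<Delta>) \<Theta> @ \<Delta> @ \<Xi> \<turnstile> lift (length \<Delta>) (length \<Theta>) (Var n) :
    lift (length \<Delta>) (length \<Theta>) (((\<Theta> @ \<Xi>) ! n) \<up> Suc n)"
proof (cases "n < length \<Theta>")
  case True
  then show ?thesis using var[OF assms(1), of n] by (simp add: nth_append nth_lift_ctx)
next
  case False
  then obtain m where "n = length \<Theta> + m" using le_Suc_ex not_less by blast
  then show ?thesis using var[OF assms(1), of "n + length \<Delta>"] assms(2)
    by (simp add: nth_append add.commute add.left_commute)
qed

text \<open>The insertion point lies in the middle of the context because binder rules extend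
  \<open>\<Theta>\<close> during the induction. The three judgements are treated together, since the
  variable rule relies on the claim about contexts.\<close>

lemma weakening:
  "ctx \<Gamma> \<Longrightarrow> \<Gamma> = \<Theta> @ \<Xi> \<Longrightarrow> ctx (\<Delta> @ \<Xi>) \<Longrightarrow> ctx (lift_ctx (length \<Delta>) \<Theta> @ \<Delta> @ \<Xi>)"
  "\<Gamma> \<turnstile> t : A \<Longrightarrow> \<Gamma> = \<Theta> @ \<Xi> \<Longrightarrow> ctx (\<Delta> @ \<Xi>) \<Longrightarrow>
     lift_ctx (length \<Delta>) \<Theta> @ \<Delta> @ \<Xi> \<turnstile> lift (length \<Delta>) (length \<Theta>) t : lift (length \<Delta>) (length \<Theta>) A"
  "\<Gamma> \<turnstile> t \<equiv> u : A \<Longrightarrow> \<Gamma> = \<Theta> @ \<Xi> \<Longrightarrow> ctx (\<Delta> @ \<Xi>) \<Longrightarrow>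
     lift_ctx (length \<Delta>) \<Theta> @ \<Delta> @ \<Xi> \<turnstile> lift (length \<Delta>) (length \<Theta>) t \<equiv> lift (length \<Delta>) (length \<Theta>) u : lift (length \<Delta>) (length \<Theta>) A"
proof (induction arbitrary: \<Theta> and \<Theta> and \<Theta> rule: ctx_typing_equal.inducts)
  case (ctx_cons \<Gamma> A i)
  then show ?case by (cases \<Theta>) (auto intro: ctx_typing_equal.intros)
next
  case (var \<Gamma> n) then show ?case by (metis lift_var)
\<comment> \<open>In every other case the lifted premises are premises of the same rule again, once
  lifting has been moved through \<open>inst\<close>; \<open>1\<close> is unfolded to agree with the
  form left by the simplifier.\<close>
qed (simp_all add: lift_inst, (rule ctx_typing_equal.intros[unfolded One_nat_def]; assumption)+)

lemma subst_var:
  assumes "ctx (subst_ctx s \<Theta> @ \<Xi>)" and "n < length (\<Theta> @ S # \<Xi>)" and "\<Xi> \<turnstile> s : S"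
  shows "subst_ctx s \<Theta> @ \<Xi> \<turnstile> subst (length \<Theta>) s (Var n) :
    subst (length \<Theta>) s (((\<Theta> @ S # \<Xi>) ! n) \<up> Suc n)"
proof -
  consider "n < length \<Theta>" | "n = length \<Theta>" | "n > length \<Theta>" by linarith
  then show ?thesis
  proof cases
    case 1
    then show ?thesis using var[OF assms(1), of n] by (simp add: nth_append nth_subst_ctx)
  next
    \<comment> \<open>The variable is the one being replaced: \<open>s\<close> is typed over
      \<open>\<Xi>\<close> and has to be weakened by the whole substituted extension.\<close>
    case 2
    then show ?thesis using weakening(2)[OF assms(3), of "[]" \<Xi> "subst_ctx s \<Theta>"] assms(1)
      by (simp add: nth_append)
  next
    case 3
    then obtain m where "n = Suc (length \<Theta> + m)" using less_imp_Suc_add by blast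
    then show ?thesis using var[OF assms(1), of "length \<Theta> + m"] assms(2) by (simp add: nth_append)
  qed
qed

lemma substitution:
  "ctx \<Gamma> \<Longrightarrow> \<Gamma> = \<Theta> @ S # \<Xi> \<Longrightarrow> \<Xi> \<turnstile> s : S \<Longrightarrow> ctx (subst_ctx s \<Theta> @ \<Xi>)"
  "\<Gamma> \<turnstile> t : A \<Longrightarrow> \<Gamma> = \<Theta> @ S # \<Xi> \<Longrightarrow> \<Xi> \<turnstile> s : S \<Longrightarrow>
     subst_ctx s \<Theta> @ \<Xi> \<turnstile> subst (length \<Theta>) s t : subst (length \<Theta>) s A"
  "\<Gamma> \<turnstile> t \<equiv> u : A \<Longrightarrow> \<Gamma> = \<Theta> @ S # \<Xi> \<Longrightarrow> \<Xi> \<turnstile> s : S \<Longrightarrow>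
     subst_ctx s \<Theta> @ \<Xi> \<turnstile> subst (length \<Theta>) s t \<equiv> subst (length \<Theta>) s u : subst (length \<Theta>) s A"
proof (induction arbitrary: \<Theta> and \<Theta> and \<Theta> rule: ctx_typing_equal.inducts)
  case (ctx_cons \<Gamma> A i)
  then show ?case by (cases \<Theta>) (auto intro: ctx_typing_equal.intros typing_ctx)
next
  case (var \<Gamma> n) then show ?case by (metis subst_var)
qed (simp_all add: subst_inst, (rule ctx_typing_equal.intros[unfolded One_nat_def]; assumption)+)

section \<open>Derived rules\<close>

lemma cumul_le: "\<Gamma> \<turnstile> A : U i \<Longrightarrow> i \<le> j \<Longrightarrow> \<Gamma> \<turnstile> A : U j"
  by (induction j) (auto simp: le_Suc_eq intro: cumul)

lemma weaken_by: "\<Gamma> \<turnstile> t : A \<Longrightarrow> ctx (\<Delta> @ \<Gamma>) \<Longrightarrow> \<Delta> @ \<Gamma> \<turnstile> t \<up> length \<Delta> : A \<up> length \<Delta>"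
  using weakening(2)[of \<Gamma> t A "[]" \<Gamma> \<Delta>] by simp

lemma weaken1: "\<Gamma> \<turnstile> t : A \<Longrightarrow> ctx (B # \<Gamma>) \<Longrightarrow> B # \<Gamma> \<turnstile> t \<up> Suc 0 : A \<up> Suc 0"
  using weaken_by[of \<Gamma> t A "[B]"] by simp

lemma weaken2: "\<Gamma> \<turnstile> t : A \<Longrightarrow> ctx (C # B # \<Gamma>) \<Longrightarrow> C # B # \<Gamma> \<turnstile> t \<up> Suc (Suc 0) : A \<up> Suc (Suc 0)"
  using weaken_by[of \<Gamma> t A "[C, B]"] by simp

lemma inst_typing: "A # \<Gamma> \<turnstile> t : B \<Longrightarrow> \<Gamma> \<turnstile> a : A \<Longrightarrow> \<Gamma> \<turnstile> inst t a : inst B a"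
  using substitution(2)[of "A # \<Gamma>" t B "[]" A \<Gamma> a] by simp

text \<open>The motive of \<open>J\<close> lives over an endpoint and a path; this fills in the
  endpoint while the path is still free.\<close>

lemma subst1_typing:
  "C # A # \<Gamma> \<turnstile> t : B \<Longrightarrow> \<Gamma> \<turnstile> a : A \<Longrightarrow> inst C a # \<Gamma> \<turnstile> subst (Suc 0) a t : subst (Suc 0) a B"
  by (drule substitution(2)[where \<Theta> = "[C]"]) auto

text \<open>In the \<open>_at\<close> variants the result type, and in \<open>beta_at\<close> also
  the reduct, is a variable constrained by an equation. Index arithmetic thus becomes a side goal
  for the simplifier instead of a unification problem.\<close>

lemma var_at: "ctx \<Gamma> \<Longrightarrow> n < length \<Gamma> \<Longrightarrow> T = (\<Gamma> ! n) \<up> Suc n \<Longrightarrow> \<Gamma> \<turnstile> Var n : T"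
  by (simp only: var)
lemma App_at: "\<Gamma> \<turnstile> f : Pi A B \<Longrightarrow> \<Gamma> \<turnstile> a : A \<Longrightarrow> T = inst B a \<Longrightarrow> \<Gamma> \<turnstile> App f a : T"
  by (auto intro: Pi_elim)
lemma beta_at:
  "A # \<Gamma> \<turnstile> t : B \<Longrightarrow> \<Gamma> \<turnstile> a : A \<Longrightarrow> u = inst t a \<Longrightarrow> T = inst B a \<Longrightarrow> \<Gamma> \<turnstile> App (Lam t) a \<equiv> u : T"
  by (auto intro: Pi_beta)
lemma App_cong_at:
  "\<Gamma> \<turnstile> f \<equiv> f' : Pi A B \<Longrightarrow> \<Gamma> \<turnstile> a \<equiv> a' : A \<Longrightarrow> T = inst B a \<Longrightarrow> \<Gamma> \<turnstile> App f a \<equiv> App f' a' : T"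
  by (auto intro: App_cong)

section \<open>Rules for arrows, binary products and propositions\<close>

lemma Arr_form: "\<Gamma> \<turnstile> A : U i \<Longrightarrow> \<Gamma> \<turnstile> B : U i \<Longrightarrow> \<Gamma> \<turnstile> A \<rightarrowtriangle> B : U i"
  unfolding Arr_def using Pi_form[of \<Gamma> A i "B \<up> 1"] weaken1[of \<Gamma> B "U i" A] ctx_cons[of \<Gamma> A i] by simp

lemma Arr_intro: "A # \<Gamma> \<turnstile> t : B \<up> Suc 0 \<Longrightarrow> \<Gamma> \<turnstile> Lam t : A \<rightarrowtriangle> B"
  unfolding Arr_def using Pi_intro by simp

lemma Arr_elim: "\<Gamma> \<turnstile> f : A \<rightarrowtriangle> B \<Longrightarrow> \<Gamma> \<turnstile> a : A \<Longrightarrow> \<Gamma> \<turnstile> App f a : B"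
  unfolding Arr_def by (erule App_at) simp_all

lemma Arr_cong: "\<Gamma> \<turnstile> f \<equiv> f' : A \<rightarrowtriangle> B \<Longrightarrow> \<Gamma> \<turnstile> a \<equiv> a' : A \<Longrightarrow> \<Gamma> \<turnstile> App f a \<equiv> App f' a' : B"
  unfolding Arr_def by (erule App_cong_at) simp_all

lemma Prod_form: "\<Gamma> \<turnstile> A : U i \<Longrightarrow> \<Gamma> \<turnstile> B : U i \<Longrightarrow> \<Gamma> \<turnstile> A \<otimes> B : U i"
  unfolding Prod_def using Sig_form[of \<Gamma> A i "B \<up> 1"] weaken1[of \<Gamma> B "U i" A] ctx_cons[of \<Gamma> A i] by simp

lemma Prod_intro:
  "\<Gamma> \<turnstile> A : U i \<Longrightarrow> \<Gamma> \<turnstile> B : U i \<Longrightarrow> \<Gamma> \<turnstile> a : A \<Longrightarrow> \<Gamma> \<turnstile> b : B \<Longrightarrow> \<Gamma> \<turnstile> Pr a b : A \<otimes> B"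
  unfolding Prod_def using Sig_intro[of \<Gamma> a A "B \<up> 1" i b] weaken1[of \<Gamma> B "U i" A] ctx_cons[of \<Gamma> A i] by simp

lemma Prod_elim1: "\<Gamma> \<turnstile> p : A \<otimes> B \<Longrightarrow> \<Gamma> \<turnstile> Pr1 p : A"
  unfolding Prod_def by (rule Sig_elim1)

lemma Prod_elim2: "\<Gamma> \<turnstile> p : A \<otimes> B \<Longrightarrow> \<Gamma> \<turnstile> Pr2 p : B"
  unfolding Prod_def using Sig_elim2[of \<Gamma> p A "B \<up> 1"] by simp

lemma Iff_intro:
  "\<Gamma> \<turnstile> A : U i \<Longrightarrow> \<Gamma> \<turnstile> B : U i \<Longrightarrow> \<Gamma> \<turnstile> f : A \<rightarrowtriangle> B \<Longrightarrow> \<Gamma> \<turnstile> g : B \<rightarrowtriangle> A \<Longrightarrow> \<Gamma> \<turnstile> Pr f g : A \<leftrightharpoons> B"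
  unfolding Iff_def by (rule Prod_intro[OF Arr_form Arr_form])

lemma isProp_form: assumes "\<Gamma> \<turnstile> A : U i" shows "\<Gamma> \<turnstile> isProp A : U i"
proof -
  have 1: "A # \<Gamma> \<turnstile> A \<up> Suc 0 : U i" using weaken1[OF assms ctx_cons[OF assms]] by simp
  have 2: "A \<up> Suc 0 # A # \<Gamma> \<turnstile> A \<up> Suc (Suc 0) : U i" using weaken2[OF assms ctx_cons[OF 1]] by simp
  show ?thesis unfolding isProp_def
    using 2 by (intro Pi_form[OF assms Pi_form[OF 1[folded One_nat_def]]] Id_form var_at)
      (simp_all add: numeral_2_eq_2 ctx_cons[OF 1])
qed

lemma isProp_elim1:
  assumes "\<Gamma> \<turnstile> h : isProp A" "\<Gamma> \<turnstile> a : A"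
  shows "\<Gamma> \<turnstile> App h a : Pi A (Id (A \<up> Suc 0) (a \<up> Suc 0) (Var 0))"
  by (rule App_at[OF assms(1)[unfolded isProp_def] assms(2)]) (simp add: numeral_2_eq_2)

lemma isProp_elim:
  assumes "\<Gamma> \<turnstile> h : isProp A" "\<Gamma> \<turnstile> a : A" "\<Gamma> \<turnstile> b : A"
  shows "\<Gamma> \<turnstile> App2 h a b : Id A a b"
  by (rule App_at[OF isProp_elim1[OF assms(1,2)] assms(3)]) simp

lemma isProp_intro:
  "A \<up> Suc 0 # A # \<Gamma> \<turnstile> t : Id (A \<up> Suc (Suc 0)) (Var (Suc 0)) (Var 0) \<Longrightarrow> \<Gamma> \<turnstile> Lam (Lam t) : isProp A"
  unfolding isProp_def by (intro Pi_intro) (simp add: numeral_2_eq_2)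

lemma Id_conv:
  assumes "\<Gamma> \<turnstile> p : Id A a b" "\<Gamma> \<turnstile> A \<equiv> A' : U i" "\<Gamma> \<turnstile> a \<equiv> a' : A" "\<Gamma> \<turnstile> b \<equiv> b' : A"
  shows "\<Gamma> \<turnstile> p : Id A' a' b'"
  by (rule conv[OF assms(1) Id_cong[OF assms(2-4)]])

text \<open>A motive is a function into a universe, so the rules for \<open>J\<close> speak of
  \<open>App2 C b p\<close>. Two beta steps turn this into the instantiation of an open type
  \<open>T\<close>; \<open>J_at\<close> and \<open>J_beta_at\<close> hide the conversion.\<close>

lemma J_motive:
  assumes A: "\<Gamma> \<turnstile> A : U k" and a: "\<Gamma> \<turnstile> a : A" and b: "\<Gamma> \<turnstile> b : A" and p: "\<Gamma> \<turnstile> p : Id A a b"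
    and T: "Id (A \<up> Suc 0) (a \<up> Suc 0) (Var 0) # A # \<Gamma> \<turnstile> T : U i"
  shows "\<Gamma> \<turnstile> App2 (Lam (Lam T)) b p \<equiv> inst (subst (Suc 0) b T) p : U i"
proof (rule eq_trans)
  have 1: "Id A a b # \<Gamma> \<turnstile> subst (Suc 0) b T : U i"
    using subst1_typing[OF T b] by simp
  have "\<Gamma> \<turnstile> App (Lam (Lam T)) b \<equiv> Lam (subst (Suc 0) b T) : Pi (Id A a b) (U i)"
    by (rule beta_at[OF Pi_intro[OF T] b]) auto
  then show "\<Gamma> \<turnstile> App2 (Lam (Lam T)) b p \<equiv> App (Lam (subst (Suc 0) b T)) p : U i"
    by (rule App_cong_at[OF _ eq_refl[OF p]]) simp
  show "\<Gamma> \<turnstile> App (Lam (subst (Suc 0) b T)) p \<equiv> inst (subst (Suc 0) b T) p : U i"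
    by (rule beta_at[OF 1 p]) auto
qed

lemma J_motive_typing:
  assumes T: "Id (A \<up> Suc 0) (a \<up> Suc 0) (Var 0) # A # \<Gamma> \<turnstile> T : U i"
  shows "\<Gamma> \<turnstile> Lam (Lam T) : Pi A (Pi (Id (A \<up> 1) (a \<up> 1) (Var 0)) (U i))"
  using Pi_intro[OF Pi_intro[OF T]] by simp

lemma J_at:
  assumes A: "\<Gamma> \<turnstile> A : U k" and a: "\<Gamma> \<turnstile> a : A" and b: "\<Gamma> \<turnstile> b : A" and p: "\<Gamma> \<turnstile> p : Id A a b"
    and T: "Id (A \<up> Suc 0) (a \<up> Suc 0) (Var 0) # A # \<Gamma> \<turnstile> T : U i"
    and d: "\<Gamma> \<turnstile> d : inst (subst (Suc 0) a T) (Refl a)"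
    and R: "R = inst (subst (Suc 0) b T) p"
  shows "\<Gamma> \<turnstile> J (Lam (Lam T)) d p : R"
proof -
  have "\<Gamma> \<turnstile> d : App2 (Lam (Lam T)) a (Refl a)"
    using d eq_sym[OF J_motive[OF A a a Id_intro[OF a] T]] by (rule conv)
  then have "\<Gamma> \<turnstile> J (Lam (Lam T)) d p : App2 (Lam (Lam T)) b p"
    by (rule Id_elim[OF J_motive_typing[OF T] _ p])
  then show ?thesis unfolding R using J_motive[OF A a b p T] by (rule conv)
qed

lemma J_beta_at:
  assumes A: "\<Gamma> \<turnstile> A : U k" and a: "\<Gamma> \<turnstile> a : A"
    and T: "Id (A \<up> Suc 0) (a \<up> Suc 0) (Var 0) # A # \<Gamma> \<turnstile> T : U i"
    and d: "\<Gamma> \<turnstile> d : inst (subst (Suc 0) a T) (Refl a)"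
    and R: "R = inst (subst (Suc 0) a T) (Refl a)"
  shows "\<Gamma> \<turnstile> J (Lam (Lam T)) d (Refl a) \<equiv> d : R"
proof -
  have *: "\<Gamma> \<turnstile> App2 (Lam (Lam T)) a (Refl a) \<equiv> R : U i"
    unfolding R by (rule J_motive[OF A a a Id_intro[OF a] T])
  have "\<Gamma> \<turnstile> d : App2 (Lam (Lam T)) a (Refl a)"
    using d[folded R] eq_sym[OF *] by (rule conv)
  then have "\<Gamma> \<turnstile> J (Lam (Lam T)) d (Refl a) \<equiv> d : App2 (Lam (Lam T)) a (Refl a)"
    by (rule Id_beta[OF J_motive_typing[OF T] a])
  then show ?thesis using * by (rule eq_conv)
qed

lemma ctx_Id:
  assumes A: "\<Gamma> \<turnstile> A : U i" and a: "\<Gamma> \<turnstile> a : A"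
  shows "ctx (Id (A \<up> Suc 0) (a \<up> Suc 0) (Var 0) # A # \<Gamma>)"
proof -
  have c: "ctx (A # \<Gamma>)" using A by (rule ctx_cons)
  have "A # \<Gamma> \<turnstile> A \<up> Suc 0 : U i" using weaken1[OF A c] by simp
  moreover have "A # \<Gamma> \<turnstile> a \<up> Suc 0 : A \<up> Suc 0" using weaken1[OF a c] by simp
  moreover have "A # \<Gamma> \<turnstile> Var 0 : A \<up> Suc 0" by (rule var_at[OF c]) auto
  ultimately show ?thesis by (intro ctx_cons Id_form)
qed

section \<open>Path operations, and propositions as sets\<close>

lemma lift_path_sym [simp]: "lift n k (path_sym X x p) = path_sym (lift n k X) (lift n k x) (lift n k p)"
  by (simp add: path_sym_def numeral_2_eq_2)

lemma lift_path_trans [simp]: "lift n k (path_trans X x p q) = path_trans (lift n k X) (lift n k x) (lift n k p) (lift n k q)"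
  by (simp add: path_trans_def numeral_2_eq_2)

lemma lift_path_sym_trans [simp]: "lift n k (path_sym_trans X x p) = path_sym_trans (lift n k X) (lift n k x) (lift n k p)"
  by (simp add: path_sym_trans_def numeral_2_eq_2)

lemma lift_prop_path [simp]: "lift n k (prop_path X h x p) = prop_path (lift n k X) (lift n k h) (lift n k x) (lift n k p)"
  by (simp add: prop_path_def numeral_2_eq_2)

lemma subst_path_sym [simp]: "subst k s (path_sym X x p) = path_sym (subst k s X) (subst k s x) (subst k s p)"
  by (simp add: path_sym_def numeral_2_eq_2)

lemma subst_path_trans [simp]: "subst k s (path_trans X x p q) = path_trans (subst k s X) (subst k s x) (subst k s p) (subst k s q)"
  by (simp add: path_trans_def numeral_2_eq_2)

lemma subst_path_sym_trans [simp]: "subst k s (path_sym_trans X x p) = path_sym_trans (subst k s X) (subst k s x) (subst k s p)"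
  by (simp add: path_sym_trans_def numeral_2_eq_2)

lemma subst_prop_path [simp]: "subst k s (prop_path X h x p) = prop_path (subst k s X) (subst k s h) (subst k s x) (subst k s p)"
  by (simp add: prop_path_def numeral_2_eq_2)

lemma path_sym_motive:
  assumes X: "\<Gamma> \<turnstile> X : U i" and x: "\<Gamma> \<turnstile> x : X"
  shows "Id (X \<up> Suc 0) (x \<up> Suc 0) (Var 0) # X # \<Gamma> \<turnstile> Id (X \<up> 2) (Var 1) (x \<up> 2) : U i"
  using weaken2[OF X ctx_Id[OF X x]] weaken2[OF x ctx_Id[OF X x]]
  by (intro Id_form var_at) (simp_all add: numeral_2_eq_2 ctx_Id[OF X x])

lemma path_sym_typing:
  assumes X: "\<Gamma> \<turnstile> X : U i" and x: "\<Gamma> \<turnstile> x : X" and y: "\<Gamma> \<turnstile> y : X" and p: "\<Gamma> \<turnstile> p : Id X x y"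
  shows "\<Gamma> \<turnstile> path_sym X x p : Id X y x"
  unfolding path_sym_def
  by (rule J_at[OF X x y p path_sym_motive[OF X x]]) (simp_all add: numeral_2_eq_2 Id_intro x)

lemma path_sym_Refl:
  assumes X: "\<Gamma> \<turnstile> X : U i" and x: "\<Gamma> \<turnstile> x : X"
  shows "\<Gamma> \<turnstile> path_sym X x (Refl x) \<equiv> Refl x : Id X x x"
  unfolding path_sym_def
  by (rule J_beta_at[OF X x path_sym_motive[OF X x]]) (simp_all add: numeral_2_eq_2 Id_intro x)

lemma path_trans_motive:
  assumes X: "\<Gamma> \<turnstile> X : U i" and x: "\<Gamma> \<turnstile> x : X" and y: "\<Gamma> \<turnstile> y : X"
  shows "Id (X \<up> Suc 0) (y \<up> Suc 0) (Var 0) # X # \<Gamma> \<turnstile> Id (X \<up> 2) (x \<up> 2) (Var 1) : U i"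
  using weaken2[OF X ctx_Id[OF X y]] weaken2[OF x ctx_Id[OF X y]]
  by (intro Id_form var_at) (simp_all add: numeral_2_eq_2 ctx_Id[OF X y])

lemma path_trans_typing:
  assumes X: "\<Gamma> \<turnstile> X : U i" and x: "\<Gamma> \<turnstile> x : X" and y: "\<Gamma> \<turnstile> y : X" and z: "\<Gamma> \<turnstile> z : X"
    and p: "\<Gamma> \<turnstile> p : Id X x y" and q: "\<Gamma> \<turnstile> q : Id X y z"
  shows "\<Gamma> \<turnstile> path_trans X x p q : Id X x z"
  unfolding path_trans_def
  by (rule J_at[OF X y z q path_trans_motive[OF X x y]]) (simp_all add: numeral_2_eq_2 p)

lemma path_trans_Refl:
  assumes X: "\<Gamma> \<turnstile> X : U i" and x: "\<Gamma> \<turnstile> x : X" and y: "\<Gamma> \<turnstile> y : X" and p: "\<Gamma> \<turnstile> p : Id X x y"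
  shows "\<Gamma> \<turnstile> path_trans X x p (Refl y) \<equiv> p : Id X x y"
  unfolding path_trans_def
  by (rule J_beta_at[OF X y path_trans_motive[OF X x y]]) (simp_all add: numeral_2_eq_2 p)

text \<open>At \<open>Refl x\<close> the inverse, and then the composite, compute to
  \<open>Refl x\<close>, so after a conversion \<open>Refl (Refl x)\<close> serves as base case of
  the path induction.\<close>

lemma path_sym_trans_typing:
  assumes X: "\<Gamma> \<turnstile> X : U i" and x: "\<Gamma> \<turnstile> x : X" and y: "\<Gamma> \<turnstile> y : X" and p: "\<Gamma> \<turnstile> p : Id X x y"
  shows "\<Gamma> \<turnstile> path_sym_trans X x p : Id (Id X y y) (Refl y) (path_trans X y (path_sym X x p) p)"
proof -
  note c = ctx_Id[OF X x]
  let ?G = "Id (X \<up> Suc 0) (x \<up> Suc 0) (Var 0) # X # \<Gamma>"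
  have X2: "?G \<turnstile> X \<up> 2 : U i" using weaken2[OF X c] by (simp add: numeral_2_eq_2)
  have x2: "?G \<turnstile> x \<up> 2 : X \<up> 2" using weaken2[OF x c] by (simp add: numeral_2_eq_2)
  have v1: "?G \<turnstile> Var 1 : X \<up> 2" by (rule var_at[OF c]) (simp_all add: numeral_2_eq_2)
  have v0: "?G \<turnstile> Var 0 : Id (X \<up> 2) (x \<up> 2) (Var 1)" by (rule var_at[OF c]) (simp_all add: numeral_2_eq_2)
  have T: "?G \<turnstile> Id (Id (X \<up> 2) (Var 1) (Var 1)) (Refl (Var 1))
      (path_trans (X \<up> 2) (Var 1) (path_sym (X \<up> 2) (x \<up> 2) (Var 0)) (Var 0)) : U i"
    by (rule Id_form[OF Id_form[OF X2 v1 v1] Id_intro[OF v1]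
      path_trans_typing[OF X2 v1 x2 v1 path_sym_typing[OF X2 x2 v1 v0] v0]])
  note r = Id_intro[OF x]
  have s: "\<Gamma> \<turnstile> path_sym X x (Refl x) : Id X x x" by (rule path_sym_typing[OF X x x r])
  have "\<Gamma> \<turnstile> path_trans X x (path_sym X x (Refl x)) (Refl x) \<equiv> Refl x : Id X x x"
    by (rule eq_trans[OF path_trans_Refl[OF X x x s] path_sym_Refl[OF X x]])
  then have "\<Gamma> \<turnstile> Refl (Refl x) : Id (Id X x x) (Refl x) (path_trans X x (path_sym X x (Refl x)) (Refl x))"
    by (rule Id_conv[OF Id_intro[OF r] eq_refl[OF Id_form[OF X x x]] eq_refl[OF r] eq_sym])
  then show ?thesis unfolding path_sym_trans_def
    by (intro J_at[OF X x y p T]) (simp_all add: numeral_2_eq_2)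
qed

text \<open>Path induction reduces to \<open>p = Refl x\<close>, where the right-hand side is the
  inverse of \<open>App2 h x x\<close> followed by \<open>App2 h x x\<close>, contracted by
  \<open>path_sym_trans\<close>. The inverse is there as a correction: \<open>App2 h x x\<close>
  itself is an arbitrary loop.\<close>

lemma prop_path_typing:
  assumes X: "\<Gamma> \<turnstile> X : U i" and h: "\<Gamma> \<turnstile> h : isProp X"
    and x: "\<Gamma> \<turnstile> x : X" and y: "\<Gamma> \<turnstile> y : X" and p: "\<Gamma> \<turnstile> p : Id X x y"
  shows "\<Gamma> \<turnstile> prop_path X h x p :
    Id (Id X x y) p (path_trans X x (path_sym X x (App2 h x x)) (App2 h x y))"
proof -
  note c = ctx_Id[OF X x]
  let ?G = "Id (X \<up> Suc 0) (x \<up> Suc 0) (Var 0) # X # \<Gamma>"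
  have X2: "?G \<turnstile> X \<up> 2 : U i" using weaken2[OF X c] by (simp add: numeral_2_eq_2)
  have h2: "?G \<turnstile> h \<up> 2 : isProp (X \<up> 2)" using weaken2[OF h c] by (simp add: numeral_2_eq_2)
  have x2: "?G \<turnstile> x \<up> 2 : X \<up> 2" using weaken2[OF x c] by (simp add: numeral_2_eq_2)
  have v1: "?G \<turnstile> Var 1 : X \<up> 2" by (rule var_at[OF c]) (simp_all add: numeral_2_eq_2)
  have v0: "?G \<turnstile> Var 0 : Id (X \<up> 2) (x \<up> 2) (Var 1)" by (rule var_at[OF c]) (simp_all add: numeral_2_eq_2)
  have T: "?G \<turnstile> Id (Id (X \<up> 2) (x \<up> 2) (Var 1)) (Var 0) (path_trans (X \<up> 2) (x \<up> 2)
      (path_sym (X \<up> 2) (x \<up> 2) (App2 (h \<up> 2) (x \<up> 2) (x \<up> 2))) (App2 (h \<up> 2) (x \<up> 2) (Var 1))) : U i"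
    by (rule Id_form[OF Id_form[OF X2 x2 v1] v0 path_trans_typing[OF X2 x2 x2 v1
      path_sym_typing[OF X2 x2 x2 isProp_elim[OF h2 x2 x2]] isProp_elim[OF h2 x2 v1]]])
  show ?thesis unfolding prop_path_def
    by (rule J_at[OF X x y p T])
      (use path_sym_trans_typing[OF X x x isProp_elim[OF h x x]] in \<open>simp_all add: numeral_2_eq_2\<close>)
qed

lemma prop_set_typing:
  assumes X: "\<Gamma> \<turnstile> X : U i" and h: "\<Gamma> \<turnstile> h : isProp X" and x: "\<Gamma> \<turnstile> x : X" and y: "\<Gamma> \<turnstile> y : X"
    and p: "\<Gamma> \<turnstile> p : Id X x y" and q: "\<Gamma> \<turnstile> q : Id X x y"
  shows "\<Gamma> \<turnstile> prop_set X h x y p q : Id (Id X x y) p q"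
proof -
  let ?w = "path_trans X x (path_sym X x (App2 h x x)) (App2 h x y)"
  have w: "\<Gamma> \<turnstile> ?w : Id X x y"
    by (rule path_trans_typing[OF X x x y path_sym_typing[OF X x x isProp_elim[OF h x x]] isProp_elim[OF h x y]])
  note I = Id_form[OF X x y]
  show ?thesis unfolding prop_set_def
    by (rule path_trans_typing[OF I p w q prop_path_typing[OF X h x y p]
      path_sym_typing[OF I q w prop_path_typing[OF X h x y q]]])
qed

section \<open>Function extensionality and the proposition of being a proposition\<close>

lemma App_weaken_Var0:
  assumes "\<Gamma> \<turnstile> A : U i" "\<Gamma> \<turnstile> f : Pi A B" shows "A # \<Gamma> \<turnstile> App (f \<up> Suc 0) (Var 0) : B"
  by (rule App_at[OF weaken1[OF assms(2) ctx_cons[OF assms(1)], unfolded lift.simps]])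
    (simp_all add: var_at ctx_cons[OF assms(1)])

lemma Arr_weaken_Var0:
  "\<Gamma> \<turnstile> A : U i \<Longrightarrow> \<Gamma> \<turnstile> f : A \<rightarrowtriangle> B \<Longrightarrow> A # \<Gamma> \<turnstile> App (f \<up> Suc 0) (Var 0) : B \<up> Suc 0"
  using App_weaken_Var0[of \<Gamma> A i f "B \<up> Suc 0"] by (simp add: Arr_def)

lemma beta_weaken_Var0:
  assumes A: "\<Gamma> \<turnstile> A : U i" and t: "A # \<Gamma> \<turnstile> t : B"
  shows "A # \<Gamma> \<turnstile> App (Lam t \<up> Suc 0) (Var 0) \<equiv> t : B"
proof -
  have c: "ctx (A # \<Gamma>)" using A by (rule ctx_cons)
  have "A \<up> Suc 0 # A # \<Gamma> \<turnstile> lift (Suc 0) (Suc 0) t : lift (Suc 0) (Suc 0) B"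
    using weakening(2)[OF t, of "[A]" \<Gamma> "[A]"] c by simp
  then show ?thesis unfolding lift.simps
    by (rule beta_at) (simp_all add: var_at c)
qed

text \<open>\<open>FunExt\<close> takes the family as a function, so its type mentions
  \<open>App (Lam B \<up> Suc 0) (Var 0)\<close> in place of \<open>B\<close>. The three arguments
  are converted on the way in and the resulting identity type on the way out.\<close>

lemma funext_typing:
  assumes A: "\<Gamma> \<turnstile> A : U i" and B: "A # \<Gamma> \<turnstile> B : U i"
    and f: "\<Gamma> \<turnstile> f : Pi A B" and g: "\<Gamma> \<turnstile> g : Pi A B"
    and h: "A # \<Gamma> \<turnstile> h : Id B (App (f \<up> Suc 0) (Var 0)) (App (g \<up> Suc 0) (Var 0))"
  shows "\<Gamma> \<turnstile> funext i A (Lam B) f g (Lam h) : Id (Pi A B) f g"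
proof -
  let ?B = "App (Lam B \<up> Suc 0) (Var 0)"
  have cg: "ctx \<Gamma>" using A by (rule typing_ctx)
  have LB: "\<Gamma> \<turnstile> Lam B : A \<rightarrowtriangle> U i" using B by (intro Arr_intro) simp
  have eB: "A # \<Gamma> \<turnstile> B \<equiv> ?B : U i" by (rule eq_sym[OF beta_weaken_Var0[OF A B]])
  have eP: "\<Gamma> \<turnstile> Pi A B \<equiv> Pi A ?B : U i" by (rule Pi_cong[OF eq_refl[OF A] eB])
  have f': "\<Gamma> \<turnstile> f : Pi A ?B" by (rule conv[OF f eP])
  have g': "\<Gamma> \<turnstile> g : Pi A ?B" by (rule conv[OF g eP])
  have h': "\<Gamma> \<turnstile> Lam h : Pi A (Id ?B (App (f \<up> Suc 0) (Var 0)) (App (g \<up> Suc 0) (Var 0)))"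
    by (rule Pi_intro[OF Id_conv[OF h eB eq_refl[OF App_weaken_Var0[OF A f]] eq_refl[OF App_weaken_Var0[OF A g]]]])
  note ty = FunExt[OF cg, of i, unfolded FunExt_type_def Let_def]
  have "\<Gamma> \<turnstile> funext i A (Lam B) f g (Lam h) : Id (Pi A ?B) f g"
    by (rule Arr_elim[OF App_at[OF App_at[OF App_at[OF App_at[OF ty A] LB] f'[unfolded lift.simps]]
      g'[unfolded lift.simps]] h'[unfolded lift.simps]]) (simp add: eval_nat_numeral)+
  then show ?thesis
    by (rule Id_conv[OF _ eq_sym[OF eP] eq_refl[OF f'] eq_refl[OF g']])
qed

text \<open>Two witnesses applied to the same points give parallel paths in \<open>X\<close>. One
  witness makes \<open>X\<close> a set, so these paths agree, and function extensionality in each of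
  the two arguments carries this over to the witnesses.\<close>

lemma isProp_isProp_typing:
  assumes X: "\<Gamma> \<turnstile> X : U i"
  shows "\<Gamma> \<turnstile> isProp_isProp i X : isProp (isProp X)"
proof -
  let ?P = "isProp X" let ?G2 = "?P \<up> Suc 0 # ?P # \<Gamma>"
  let ?G3 = "X \<up> 2 # ?G2" let ?G4 = "X \<up> 3 # ?G3"
  have P: "\<Gamma> \<turnstile> ?P : U i" by (rule isProp_form[OF X])
  have c1: "ctx (?P # \<Gamma>)" by (rule ctx_cons[OF P])
  have c2: "ctx ?G2" using weaken1[OF P c1] by (intro ctx_cons[where i = i]) simp
  have X2: "?G2 \<turnstile> X \<up> 2 : U i" using weaken2[OF X c2] by (simp add: numeral_2_eq_2)
  note c3 = ctx_cons[OF X2]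
  have X3: "?G3 \<turnstile> X \<up> 3 : U i" using weaken1[OF X2 c3] by (simp add: eval_nat_numeral)
  note c4 = ctx_cons[OF X3]
  have X4: "?G4 \<turnstile> X \<up> 4 : U i" using weaken1[OF X3 c4] by (simp add: eval_nat_numeral)
  have "?G4 \<turnstile> Id (X \<up> 4) (Var 1) (Var 0) : U i"
    by (intro Id_form X4 var_at c4) (simp_all add: eval_nat_numeral)
  note I4 = this and P3 = Pi_form[OF X3 this]
  have v: "?G4 \<turnstile> Var 3 : isProp (X \<up> 4)" "?G4 \<turnstile> Var 2 : isProp (X \<up> 4)"
      "?G4 \<turnstile> Var 1 : X \<up> 4" "?G4 \<turnstile> Var 0 : X \<up> 4"
    by (intro var_at c4; simp add: eval_nat_numeral)+
  have w: "?G3 \<turnstile> Var 2 : isProp (X \<up> 3)" "?G3 \<turnstile> Var 1 : isProp (X \<up> 3)" "?G3 \<turnstile> Var 0 : X \<up> 3"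
    by (intro var_at c3; simp add: eval_nat_numeral)+
  have u: "?G2 \<turnstile> Var 1 : isProp (X \<up> 2)" "?G2 \<turnstile> Var 0 : isProp (X \<up> 2)"
    by (intro var_at c2; simp add: eval_nat_numeral)+
  have e: "isProp (X \<up> 2) = Pi (X \<up> 2) (Pi (X \<up> 3) (Id (X \<up> 4) (Var 1) (Var 0)))"
    by (simp add: isProp_def eval_nat_numeral)
  have A: "?G3 \<turnstile> App f (Var 0) : Pi (X \<up> 3) (Id (X \<up> 4) (Var 1) (Var 0))" if "?G3 \<turnstile> f : isProp (X \<up> 3)" for f
    using isProp_elim1[OF that w(3)] by (simp add: eval_nat_numeral)
  \<comment> \<open>Over \<open>?G4\<close>, \<open>Var 3\<close> and \<open>Var 2\<close> are the
    two witnesses and \<open>Var 1\<close>, \<open>Var 0\<close> the points; it is the first witness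
    that makes \<open>X\<close> a set.\<close>
  let ?h = "prop_set (X \<up> 4) (Var 3) (Var 1) (Var 0) (App2 (Var 3) (Var 1) (Var 0)) (App2 (Var 2) (Var 1) (Var 0))"
  let ?g = "funext i (X \<up> 3) (Lam (Id (X \<up> 4) (Var 1) (Var 0))) (App (Var 2) (Var 0)) (App (Var 1) (Var 0)) (Lam ?h)"
  have "?G3 \<turnstile> ?g : Id (Pi (X \<up> 3) (Id (X \<up> 4) (Var 1) (Var 0))) (App (Var 2) (Var 0)) (App (Var 1) (Var 0))"
    by (rule funext_typing[OF X3 I4 A[OF w(1)] A[OF w(2)]])
      (use prop_set_typing[OF X4 v(1,3,4) isProp_elim[OF v(1,3,4)] isProp_elim[OF v(2,3,4)]]
        in \<open>simp add: eval_nat_numeral\<close>)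
  then have "?G2 \<turnstile> funext i (X \<up> 2) (Lam (Pi (X \<up> 3) (Id (X \<up> 4) (Var 1) (Var 0)))) (Var 1) (Var 0) (Lam ?g) :
      Id (isProp (X \<up> 2)) (Var 1) (Var 0)"
    unfolding e by (intro funext_typing[OF X2 P3 u[unfolded e]]) (simp add: eval_nat_numeral)
  then show ?thesis unfolding isProp_isProp_def
    by (intro isProp_intro) (simp add: eval_nat_numeral)
qed

section \<open>Truncation, propositional extensionality, products of propositions\<close>

lemma TruncIn_typing:
  assumes "\<Gamma> \<turnstile> A : U i" "\<Gamma> \<turnstile> a : A" shows "\<Gamma> \<turnstile> App2 (TruncIn i) A a : Trunc A"
  by (rule Arr_elim[OF App_at[OF TruncIn[OF typing_ctx(1)[OF assms(1)], unfolded TruncIn_type_def] assms(1)] assms(2)]) simp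

lemma TruncProp_typing:
  assumes "\<Gamma> \<turnstile> A : U i" shows "\<Gamma> \<turnstile> App (TruncProp i) A : isProp (Trunc A)"
  by (rule App_at[OF TruncProp[OF typing_ctx(1)[OF assms(1)], unfolded TruncProp_type_def] assms(1)]) simp

lemma TruncRec_typing:
  assumes A: "\<Gamma> \<turnstile> A : U i" and B: "\<Gamma> \<turnstile> B : U j" and "\<Gamma> \<turnstile> b : isProp B" "\<Gamma> \<turnstile> f : A \<rightarrowtriangle> B" "\<Gamma> \<turnstile> a : Trunc A"
  shows "\<Gamma> \<turnstile> App (App2 (App2 (TruncRec i j) A B) b f) a : B"
proof -
  have "\<Gamma> \<turnstile> App (TruncRec i j) A : Pi (U j)
       (isProp (Var 0) \<rightarrowtriangle> (A \<up> Suc 0 \<rightarrowtriangle> Var 0) \<rightarrowtriangle> Trunc (A \<up> Suc 0) \<rightarrowtriangle> Var 0)"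
    by (rule App_at[OF TruncRec[OF typing_ctx(1)[OF A], unfolded TruncRec_type_def] A]) simp
  then have "\<Gamma> \<turnstile> App2 (TruncRec i j) A B : isProp B \<rightarrowtriangle> (A \<rightarrowtriangle> B) \<rightarrowtriangle> Trunc A \<rightarrowtriangle> B"
    by (rule App_at[OF _ B]) simp
  then show ?thesis using assms(3-5) by (blast intro: Arr_elim)
qed

lemma PropExt_typing:
  assumes P: "\<Gamma> \<turnstile> P : U i" and Q: "\<Gamma> \<turnstile> Q : U i" and "\<Gamma> \<turnstile> p : isProp P" "\<Gamma> \<turnstile> q : isProp Q"
    "\<Gamma> \<turnstile> f : P \<rightarrowtriangle> Q" "\<Gamma> \<turnstile> g : Q \<rightarrowtriangle> P"
  shows "\<Gamma> \<turnstile> App2 (App2 (App2 (PropExt i) P Q) p q) f g : Id (U i) P Q"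
proof -
  have "\<Gamma> \<turnstile> App (PropExt i) P : Pi (U i)
       (isProp (P \<up> Suc 0) \<rightarrowtriangle> isProp (Var 0) \<rightarrowtriangle> (P \<up> Suc 0 \<rightarrowtriangle> Var 0) \<rightarrowtriangle> (Var 0 \<rightarrowtriangle> P \<up> Suc 0)
         \<rightarrowtriangle> Id (U i) (P \<up> Suc 0) (Var 0))"
    by (rule App_at[OF PropExt[OF typing_ctx(1)[OF P], unfolded PropExt_type_def] P]) simp
  then have "\<Gamma> \<turnstile> App2 (PropExt i) P Q : isProp P \<rightarrowtriangle> isProp Q \<rightarrowtriangle> (P \<rightarrowtriangle> Q) \<rightarrowtriangle> (Q \<rightarrowtriangle> P) \<rightarrowtriangle> Id (U i) P Q"
    by (rule App_at[OF _ Q]) simp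
  then show ?thesis using assms(3-6) by (blast intro: Arr_elim)
qed

text \<open>Makes a product of truncations a legitimate target of truncation elimination: two
  functions agree by function extensionality because their values do.\<close>

lemma isProp_Pi:
  assumes A: "\<Gamma> \<turnstile> A : U i" and B: "A # \<Gamma> \<turnstile> B : U i" and h: "A # \<Gamma> \<turnstile> h : isProp B"
  shows "\<exists>t. \<Gamma> \<turnstile> t : isProp (Pi A B)"
proof -
  let ?P = "Pi A B" let ?G2 = "?P \<up> Suc 0 # ?P # \<Gamma>" let ?G3 = "A \<up> 2 # ?G2"
  have P: "\<Gamma> \<turnstile> ?P : U i" by (rule Pi_form[OF A B])
  have c1: "ctx (?P # \<Gamma>)" by (rule ctx_cons[OF P])
  have c2: "ctx ?G2" using weaken1[OF P c1] by (intro ctx_cons[where i = i]) simp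
  have A2: "?G2 \<turnstile> A \<up> 2 : U i" using weaken2[OF A c2] by (simp add: numeral_2_eq_2)
  note c3 = ctx_cons[OF A2]
  \<comment> \<open>The two functions to be compared enter between \<open>\<Gamma>\<close> and the
    argument of the product, so \<open>B\<close> is lifted above its variable
    \<open>0\<close>.\<close>
  have B2: "?G3 \<turnstile> lift 2 1 B : U i"
    using weakening(2)[OF B, of "[A]" \<Gamma> "[?P \<up> Suc 0, ?P]"] c2 by (simp add: numeral_2_eq_2)
  have h2: "?G3 \<turnstile> lift 2 1 h : isProp (lift 2 1 B)"
    using weakening(2)[OF h, of "[A]" \<Gamma> "[?P \<up> Suc 0, ?P]"] c2 by (simp add: numeral_2_eq_2)
  have v: "?G2 \<turnstile> Var 1 : Pi (A \<up> 2) (lift 2 1 B)" "?G2 \<turnstile> Var 0 : Pi (A \<up> 2) (lift 2 1 B)"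
    by (intro var_at c2; simp add: numeral_2_eq_2)+
  note w = App_weaken_Var0[OF A2 v(1)] App_weaken_Var0[OF A2 v(2)]
  have "?G2 \<turnstile> funext i (A \<up> 2) (Lam (lift 2 1 B)) (Var 1) (Var 0) (Lam (App2 (lift 2 1 h)
      (App (Var 1 \<up> Suc 0) (Var 0)) (App (Var 0 \<up> Suc 0) (Var 0)))) : Id (?P \<up> Suc (Suc 0)) (Var (Suc 0)) (Var 0)"
    using funext_typing[OF A2 B2 v isProp_elim[OF h2 w]] by (simp add: numeral_2_eq_2)
  then show ?thesis by (blast intro: isProp_intro)
qed

section \<open>Partial elements\<close>

text \<open>\<open>Lift\<close> and \<open>LiftD\<close> are the instances with \<open>C = isProp (Var 0)\<close> and
  \<open>C = App (D \<up> Suc 0) (Var 0)\<close>; the free variable \<open>0\<close> of \<open>C\<close> is the extent.\<close>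

definition partials :: "nat \<Rightarrow> tm \<Rightarrow> tm \<Rightarrow> tm" where
  "partials i C Y = Sig (U i) (C \<otimes> (Var 0 \<rightarrowtriangle> Y \<up> Suc 0))"

lemma Lift_partials: "Lift i Y = partials i (isProp (Var 0)) Y"
  by (simp add: Lift_def partials_def)

lemma LiftD_partials: "LiftD i D Y = partials i (App (D \<up> Suc 0) (Var 0)) Y"
  by (simp add: LiftD_def partials_def)

lemma Arr_Var0_form:
  assumes "\<Gamma> \<turnstile> Y : U i" shows "U i # \<Gamma> \<turnstile> Var 0 \<rightarrowtriangle> Y \<up> Suc 0 : U i"
proof -
  have c: "ctx (U i # \<Gamma>)" by (rule ctx_cons[OF univ[OF typing_ctx(1)[OF assms]]])
  show ?thesis using weaken1[OF assms c] by (intro Arr_form var_at) (simp_all add: c)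
qed

lemma partials_body_form:
  assumes Y: "\<Gamma> \<turnstile> Y : U i" and C: "U i # \<Gamma> \<turnstile> C : U k"
  shows "U i # \<Gamma> \<turnstile> C \<otimes> (Var 0 \<rightarrowtriangle> Y \<up> Suc 0) : U (max (Suc i) k)"
  by (intro Prod_form cumul_le[OF C] cumul_le[OF Arr_Var0_form[OF Y]]) auto

lemma partials_form:
  assumes Y: "\<Gamma> \<turnstile> Y : U i" and C: "U i # \<Gamma> \<turnstile> C : U k"
  shows "\<Gamma> \<turnstile> partials i C Y : U (max (Suc i) k)"
  unfolding partials_def
  by (rule Sig_form[OF cumul_le[OF univ[OF typing_ctx(1)[OF Y]]] partials_body_form[OF Y C]]) simp

lemma partials_elim:
  assumes "\<Gamma> \<turnstile> l : partials i C Y"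
  shows "\<Gamma> \<turnstile> Pr1 l : U i" "\<Gamma> \<turnstile> Pr2 l : inst C (Pr1 l) \<otimes> (Pr1 l \<rightarrowtriangle> Y)"
    "\<Gamma> \<turnstile> Pr1 (Pr2 l) : inst C (Pr1 l)" "\<Gamma> \<turnstile> Pr2 (Pr2 l) : Pr1 l \<rightarrowtriangle> Y"
proof -
  show "\<Gamma> \<turnstile> Pr1 l : U i" using assms unfolding partials_def by (rule Sig_elim1)
  show *: "\<Gamma> \<turnstile> Pr2 l : inst C (Pr1 l) \<otimes> (Pr1 l \<rightarrowtriangle> Y)"
    using Sig_elim2[OF assms[unfolded partials_def]] by simp
  show "\<Gamma> \<turnstile> Pr1 (Pr2 l) : inst C (Pr1 l)" "\<Gamma> \<turnstile> Pr2 (Pr2 l) : Pr1 l \<rightarrowtriangle> Y"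
    using Prod_elim1[OF *] Prod_elim2[OF *] by auto
qed

lemma partials_cong:
  assumes Y: "\<Gamma> \<turnstile> Y : U i" and C: "U i # \<Gamma> \<turnstile> C : U k" and P: "\<Gamma> \<turnstile> P : U i"
    and "\<Gamma> \<turnstile> P \<equiv> P' : U i" "\<Gamma> \<turnstile> d \<equiv> d' : inst C P" "\<Gamma> \<turnstile> v \<equiv> v' : P \<rightarrowtriangle> Y"
  shows "\<Gamma> \<turnstile> Pr P (Pr d v) \<equiv> Pr P' (Pr d' v') : partials i C Y"
proof -
  have A: "\<Gamma> \<turnstile> P \<rightarrowtriangle> Y : U i" by (rule Arr_form[OF P Y])
  have I: "\<Gamma> \<turnstile> inst C P : U k" using inst_typing[OF C P] by simp
  have "\<Gamma> \<turnstile> Pr d v \<equiv> Pr d' v' : inst C P \<otimes> (P \<rightarrowtriangle> Y)"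
    unfolding Prod_def
    by (rule Pr_cong[where i = i])
      (use assms weaken1[OF A ctx_cons[OF I]] in simp_all)
  then show ?thesis unfolding partials_def
    by (intro Pr_cong[OF assms(4) partials_body_form[OF Y C]]) simp
qed

text \<open>The computation rules accompany the typing because \<open>forget\<close> is defined
  through projections, so comparing its value on a tuple with a tuple requires reducing
  them.\<close>

lemma partials_intro:
  assumes Y: "\<Gamma> \<turnstile> Y : U i" and C: "U i # \<Gamma> \<turnstile> C : U k" and P: "\<Gamma> \<turnstile> P : U i"
    and d: "\<Gamma> \<turnstile> d : inst C P" and v: "\<Gamma> \<turnstile> v : P \<rightarrowtriangle> Y"
  shows "\<Gamma> \<turnstile> Pr P (Pr d v) : partials i C Y"
    and "\<Gamma> \<turnstile> Pr1 (Pr P (Pr d v)) \<equiv> P : U i"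
    and "\<Gamma> \<turnstile> Pr1 (Pr2 (Pr P (Pr d v))) \<equiv> d : inst C P"
    and "\<Gamma> \<turnstile> Pr2 (Pr2 (Pr P (Pr d v))) \<equiv> v : P \<rightarrowtriangle> Y"
proof -
  have A: "\<Gamma> \<turnstile> P \<rightarrowtriangle> Y : U i" by (rule Arr_form[OF P Y])
  have I: "\<Gamma> \<turnstile> inst C P : U k" using inst_typing[OF C P] by simp
  have A1: "inst C P # \<Gamma> \<turnstile> (P \<rightarrowtriangle> Y) \<up> 1 : U i" using weaken1[OF A ctx_cons[OF I]] by simp
  have v': "\<Gamma> \<turnstile> v : inst ((P \<rightarrowtriangle> Y) \<up> 1) d" using v by simp
  have dv: "\<Gamma> \<turnstile> Pr d v : inst C P \<otimes> (P \<rightarrowtriangle> Y)" unfolding Prod_def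
    by (rule Sig_intro[OF d A1 v'])
  have dv': "\<Gamma> \<turnstile> Pr d v : inst (C \<otimes> (Var 0 \<rightarrowtriangle> Y \<up> Suc 0)) P" using dv by simp
  note B = partials_body_form[OF Y C]
  show "\<Gamma> \<turnstile> Pr P (Pr d v) : partials i C Y" unfolding partials_def by (rule Sig_intro[OF P B dv'])
  show "\<Gamma> \<turnstile> Pr1 (Pr P (Pr d v)) \<equiv> P : U i" by (rule Sig_beta1[OF P B dv'])
  have e: "\<Gamma> \<turnstile> Pr2 (Pr P (Pr d v)) \<equiv> Pr d v : Sig (inst C P) ((P \<rightarrowtriangle> Y) \<up> 1)"
    using Sig_beta2[OF P B dv'] by (simp add: Prod_def)
  show "\<Gamma> \<turnstile> Pr1 (Pr2 (Pr P (Pr d v))) \<equiv> d : inst C P"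
    by (rule eq_trans[OF Pr1_cong[OF e] Sig_beta1[OF d A1 v']])
  have "\<Gamma> \<turnstile> Pr2 (Pr2 (Pr P (Pr d v))) \<equiv> Pr2 (Pr d v) : P \<rightarrowtriangle> Y" using Pr2_cong[OF e] by simp
  moreover have "\<Gamma> \<turnstile> Pr2 (Pr d v) \<equiv> v : P \<rightarrowtriangle> Y" using Sig_beta2[OF d A1 v'] by simp
  ultimately show "\<Gamma> \<turnstile> Pr2 (Pr2 (Pr P (Pr d v))) \<equiv> v : P \<rightarrowtriangle> Y" by (rule eq_trans)
qed

lemma partials_eta:
  assumes Y: "\<Gamma> \<turnstile> Y : U i" and C: "U i # \<Gamma> \<turnstile> C : U k" and l: "\<Gamma> \<turnstile> l : partials i C Y"
  shows "\<Gamma> \<turnstile> l \<equiv> Pr (Pr1 l) (Pr (Pr1 (Pr2 l)) (Pr2 (Pr2 l))) : partials i C Y"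
proof -
  note e = partials_elim[OF l]
  have "\<Gamma> \<turnstile> Pr2 l \<equiv> Pr (Pr1 (Pr2 l)) (Pr2 (Pr2 l)) : inst (C \<otimes> (Var 0 \<rightarrowtriangle> Y \<up> Suc 0)) (Pr1 l)"
    using Sig_eta[OF e(2)[unfolded Prod_def]] by (simp add: Prod_def)
  then have "\<Gamma> \<turnstile> Pr (Pr1 l) (Pr2 l) \<equiv> Pr (Pr1 l) (Pr (Pr1 (Pr2 l)) (Pr2 (Pr2 l))) : partials i C Y"
    unfolding partials_def by (rule Pr_cong[OF eq_refl[OF e(1)] partials_body_form[OF Y C]])
  with Sig_eta[OF l[unfolded partials_def]] show ?thesis unfolding partials_def by (rule eq_trans)
qed

text \<open>The type shared by the first component of a structural dominance and by
  \<open>isRosolini_isProp\<close>; stated separately, it lets both halves of the theorem use the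
  same lemmas.\<close>

definition propositional :: "nat \<Rightarrow> tm \<Rightarrow> tm" where
  "propositional i D = Pi (U i) (App (D \<up> Suc 0) (Var 0) \<rightarrowtriangle> isProp (Var 0))"

lemma lift_propositional [simp]: "lift n k (propositional i D) = propositional i (lift n k D)"
  by (simp add: propositional_def)

lemma lift_forget [simp]: "lift n k (forget m l) = forget (lift n k m) (lift n k l)"
  by (simp add: forget_def)

lemma subst_forget [simp]: "subst k s (forget m l) = forget (subst k s m) (subst k s l)"
  by (simp add: forget_def)

lemma lift_tame [simp]: "lift n k (tame m f) = tame (lift n k m) (lift n k f)"
  by (simp add: tame_def)

lemma subst_tame [simp]: "subst k s (tame m f) = tame (subst k s m) (subst k s f)"
  by (simp add: tame_def)

lemma lift_Lift [simp]: "lift n k (Lift i Y) = Lift i (lift n k Y)"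
  by (simp add: Lift_def)

lemma subst_Lift [simp]: "subst k s (Lift i Y) = Lift i (subst k s Y)"
  by (simp add: Lift_def)

lemma lift_LiftD [simp]: "lift n k (LiftD i D Y) = LiftD i (lift n k D) (lift n k Y)"
  by (simp add: LiftD_def)

lemma App_Var0_form:
  assumes D: "\<Gamma> \<turnstile> D : U i \<rightarrowtriangle> U j" shows "U i # \<Gamma> \<turnstile> App (D \<up> Suc 0) (Var 0) : U j"
proof -
  have c: "ctx (U i # \<Gamma>)" by (rule ctx_cons[OF univ[OF typing_ctx(1)[OF D]]])
  show ?thesis using weaken1[OF D c] by (intro Arr_elim[of _ _ "U i"] var_at) (simp_all add: c)
qed

lemma isProp_Var0_form: assumes "ctx \<Gamma>" shows "U i # \<Gamma> \<turnstile> isProp (Var 0) : U i"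
proof -
  have c: "ctx (U i # \<Gamma>)" by (rule ctx_cons[OF univ[OF assms]])
  show ?thesis by (intro isProp_form var_at) (simp_all add: c)
qed

lemma Lift_form: "\<Gamma> \<turnstile> Y : U i \<Longrightarrow> \<Gamma> \<turnstile> Lift i Y : U (Suc i)"
  using partials_form[OF _ isProp_Var0_form[of \<Gamma> i], of Y] typing_ctx(1) by (auto simp: Lift_partials)

lemma LiftD_form: "\<Gamma> \<turnstile> Y : U i \<Longrightarrow> \<Gamma> \<turnstile> D : U i \<rightarrowtriangle> U j \<Longrightarrow> \<Gamma> \<turnstile> LiftD i D Y : U (max (Suc i) j)"
  unfolding LiftD_partials by (rule partials_form[OF _ App_Var0_form])

lemma propositional_elim:
  assumes m: "\<Gamma> \<turnstile> m : propositional i D" and P: "\<Gamma> \<turnstile> P : U i" and d: "\<Gamma> \<turnstile> d : App D P"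
  shows "\<Gamma> \<turnstile> App2 m P d : isProp P"
  by (rule Arr_elim[OF App_at[OF m[unfolded propositional_def] P] d]) simp

lemma propositional_cong:
  assumes m: "\<Gamma> \<turnstile> m : propositional i D" and P: "\<Gamma> \<turnstile> P \<equiv> P' : U i" and d: "\<Gamma> \<turnstile> d \<equiv> d' : App D P"
  shows "\<Gamma> \<turnstile> App2 m P d \<equiv> App2 m P' d' : isProp P"
  by (rule Arr_cong[OF App_cong_at[OF eq_refl[OF m[unfolded propositional_def]] P] d]) simp

lemma forget_cong:
  assumes Y: "\<Gamma> \<turnstile> Y : U i" and D: "\<Gamma> \<turnstile> D : U i \<rightarrowtriangle> U j" and m: "\<Gamma> \<turnstile> m : propositional i D"
    and l: "\<Gamma> \<turnstile> l : LiftD i D Y" and e: "\<Gamma> \<turnstile> l \<equiv> l' : LiftD i D Y"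
  shows "\<Gamma> \<turnstile> forget m l \<equiv> forget m l' : Lift i Y"
proof -
  note el = partials_elim[OF l[unfolded LiftD_partials]]
  have e1: "\<Gamma> \<turnstile> Pr1 l \<equiv> Pr1 l' : U i" using e unfolding LiftD_def by (rule Pr1_cong)
  have e2: "\<Gamma> \<turnstile> Pr2 l \<equiv> Pr2 l' : App D (Pr1 l) \<otimes> (Pr1 l \<rightarrowtriangle> Y)"
    using Pr2_cong[OF e[unfolded LiftD_def]] by simp
  have e3: "\<Gamma> \<turnstile> Pr1 (Pr2 l) \<equiv> Pr1 (Pr2 l') : App D (Pr1 l)"
    using e2 unfolding Prod_def by (rule Pr1_cong)
  have e4: "\<Gamma> \<turnstile> Pr2 (Pr2 l) \<equiv> Pr2 (Pr2 l') : Pr1 l \<rightarrowtriangle> Y"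
    using Pr2_cong[OF e2[unfolded Prod_def]] by simp
  show ?thesis unfolding forget_def Lift_partials
    by (rule partials_cong[OF Y isProp_Var0_form el(1) e1])
      (use typing_ctx(1)[OF Y] propositional_cong[OF m e1 e3] e4 in simp_all)
qed

text \<open>The extent is kept judgementally and not only up to a path. This is what later lets
  structure on the extents of \<open>g\<close> be reused for \<open>tame m g\<close> without
  transport.\<close>

lemma forget_typing:
  assumes Y: "\<Gamma> \<turnstile> Y : U i" and m: "\<Gamma> \<turnstile> m : propositional i D" and l: "\<Gamma> \<turnstile> l : LiftD i D Y"
  shows "\<Gamma> \<turnstile> forget m l : Lift i Y" and "\<Gamma> \<turnstile> Pr1 (forget m l) \<equiv> Pr1 l : U i"
proof -
  note el = partials_elim[OF l[unfolded LiftD_partials]]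
  have "\<Gamma> \<turnstile> App2 m (Pr1 l) (Pr1 (Pr2 l)) : inst (isProp (Var 0)) (Pr1 l)"
    using propositional_elim[OF m el(1)] el(3) by simp
  note * = partials_intro(1,2)[OF Y isProp_Var0_form[OF typing_ctx(1)[OF Y]] el(1) this el(4)]
  show "\<Gamma> \<turnstile> forget m l : Lift i Y" "\<Gamma> \<turnstile> Pr1 (forget m l) \<equiv> Pr1 l : U i"
    unfolding forget_def Lift_partials by (fact *)+
qed

lemma forget_Pr:
  assumes Y: "\<Gamma> \<turnstile> Y : U i" and D: "\<Gamma> \<turnstile> D : U i \<rightarrowtriangle> U j" and m: "\<Gamma> \<turnstile> m : propositional i D"
    and P: "\<Gamma> \<turnstile> P : U i" and d: "\<Gamma> \<turnstile> d : App D P" and v: "\<Gamma> \<turnstile> v : P \<rightarrowtriangle> Y"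
  shows "\<Gamma> \<turnstile> Pr P (Pr (App2 m P d) v) \<equiv> forget m (Pr P (Pr d v)) : Lift i Y"
proof -
  note a = partials_intro[OF Y App_Var0_form[OF D] P _ v, of d]
  have d': "\<Gamma> \<turnstile> d : inst (App (D \<up> Suc 0) (Var 0)) P" using d by simp
  have e1: "\<Gamma> \<turnstile> P \<equiv> Pr1 (Pr P (Pr d v)) : U i" by (rule eq_sym[OF a(2)[OF d']])
  have e2: "\<Gamma> \<turnstile> d \<equiv> Pr1 (Pr2 (Pr P (Pr d v))) : App D P" using eq_sym[OF a(3)[OF d']] by simp
  have e3: "\<Gamma> \<turnstile> v \<equiv> Pr2 (Pr2 (Pr P (Pr d v))) : P \<rightarrowtriangle> Y" by (rule eq_sym[OF a(4)[OF d']])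
  show ?thesis unfolding forget_def Lift_partials
    by (rule partials_cong[OF Y isProp_Var0_form P e1])
      (use typing_ctx(1)[OF Y] propositional_cong[OF m e1 e2] e3 in simp_all)
qed

text \<open>The two partial elements differ only in their proofs of propositionhood, which are
  joined by a path since \<open>isProp\<close> is a proposition. After induction along that path,
  computation folds the left end into \<open>forget\<close> and eta folds the right end into
  \<open>l\<close>.\<close>

lemma forget_path:
  assumes Y: "\<Gamma> \<turnstile> Y : U i" and D: "\<Gamma> \<turnstile> D : U i \<rightarrowtriangle> U j" and m: "\<Gamma> \<turnstile> m : propositional i D"
    and l: "\<Gamma> \<turnstile> l : Lift i Y" and d: "\<Gamma> \<turnstile> d : App D (Pr1 l)"
  shows "\<exists>q. \<Gamma> \<turnstile> q : Id (Lift i Y) (forget m (Pr (Pr1 l) (Pr d (Pr2 (Pr2 l))))) l"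
proof -
  note c = typing_ctx(1)[OF Y]
  note el = partials_elim[OF l[unfolded Lift_partials], simplified]
  let ?P = "Pr1 l" let ?v = "Pr2 (Pr2 l)" let ?a = "App2 m ?P d" let ?A = "isProp ?P"
  have A: "\<Gamma> \<turnstile> ?A : U i" by (rule isProp_form[OF el(1)])
  have a: "\<Gamma> \<turnstile> ?a : ?A" by (rule propositional_elim[OF m el(1) d])
  note q = isProp_elim[OF isProp_isProp_typing[OF el(1)] a el(3)]
  note cI = ctx_Id[OF A a]
  let ?G = "Id (?A \<up> Suc 0) (?a \<up> Suc 0) (Var 0) # ?A # \<Gamma>"
  have ins: "\<Delta> \<turnstile> Pr P (Pr b v) : Lift i Z"
    if "\<Delta> \<turnstile> Z : U i" "\<Delta> \<turnstile> P : U i" "\<Delta> \<turnstile> b : isProp P" "\<Delta> \<turnstile> v : P \<rightarrowtriangle> Z" for \<Delta> Z P b v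
    unfolding Lift_partials
    by (rule partials_intro(1)[OF that(1) isProp_Var0_form[OF typing_ctx(1)[OF that(1)]] that(2) _ that(4)])
      (simp add: that(3))
  have Y2: "?G \<turnstile> Y \<up> 2 : U i" using weaken2[OF Y cI] by (simp add: numeral_2_eq_2)
  have P2: "?G \<turnstile> ?P \<up> 2 : U i" using weaken2[OF el(1) cI] by (simp add: numeral_2_eq_2)
  have a2: "?G \<turnstile> ?a \<up> 2 : isProp (?P \<up> 2)" using weaken2[OF a cI] by (simp add: numeral_2_eq_2)
  have v2: "?G \<turnstile> ?v \<up> 2 : ?P \<up> 2 \<rightarrowtriangle> Y \<up> 2" using weaken2[OF el(4) cI] by (simp add: numeral_2_eq_2)
  have v1: "?G \<turnstile> Var 1 : isProp (?P \<up> 2)" by (rule var_at[OF cI]) (simp_all add: numeral_2_eq_2)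
  \<comment> \<open>The motive keeps extent and value fixed and lets only the proof of
    propositionhood vary, as \<open>Var 1\<close>.\<close>
  have T: "?G \<turnstile> Id (Lift i (Y \<up> 2)) (Pr (?P \<up> 2) (Pr (?a \<up> 2) (?v \<up> 2)))
      (Pr (?P \<up> 2) (Pr (Var 1) (?v \<up> 2))) : U (Suc i)"
    by (rule Id_form[OF Lift_form[OF Y2] ins[OF Y2 P2 a2 v2] ins[OF Y2 P2 v1 v2]])
  note b = ins[OF Y el(1) a el(4)] and b' = ins[OF Y el(1) el(3) el(4)]
  have "\<exists>q. \<Gamma> \<turnstile> q : Id (Lift i Y) (Pr ?P (Pr ?a ?v)) (Pr ?P (Pr (Pr1 (Pr2 l)) ?v))"
    by (rule exI, rule J_at[OF A a el(3) q T, where d = "Refl (Pr ?P (Pr ?a ?v))"])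
      (use Id_intro[OF b] in \<open>simp_all add: numeral_2_eq_2\<close>)
  then show ?thesis
    using Id_conv[OF _ eq_refl[OF Lift_form[OF Y]] forget_Pr[OF Y D m el(1) d el(4)]
      eq_sym[OF partials_eta[OF Y isProp_Var0_form[OF c] l[unfolded Lift_partials], folded Lift_partials]]] by blast
qed

section \<open>Tame maps and structure on their extents\<close>

lemma tame_typing:
  assumes X: "\<Gamma> \<turnstile> X : U k" and Y: "\<Gamma> \<turnstile> Y : U i" and m: "\<Gamma> \<turnstile> m : propositional i D"
    and g: "\<Gamma> \<turnstile> g : X \<rightarrowtriangle> LiftD i D Y"
  shows "\<Gamma> \<turnstile> tame m g : X \<rightarrowtriangle> Lift i Y"
    and "X # \<Gamma> \<turnstile> App (g \<up> Suc 0) (Var 0) : LiftD i (D \<up> Suc 0) (Y \<up> Suc 0)"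
    and "X # \<Gamma> \<turnstile> App (tame m g \<up> Suc 0) (Var 0) \<equiv> forget (m \<up> Suc 0) (App (g \<up> Suc 0) (Var 0)) : Lift i (Y \<up> Suc 0)"
proof -
  note c = ctx_cons[OF X]
  show g0: "X # \<Gamma> \<turnstile> App (g \<up> Suc 0) (Var 0) : LiftD i (D \<up> Suc 0) (Y \<up> Suc 0)"
    using Arr_weaken_Var0[OF X g] by simp
  have Y1: "X # \<Gamma> \<turnstile> Y \<up> Suc 0 : U i" using weaken1[OF Y c] by simp
  have m1: "X # \<Gamma> \<turnstile> m \<up> Suc 0 : propositional i (D \<up> Suc 0)" using weaken1[OF m c] by simp
  note t = forget_typing(1)[OF Y1 m1 g0]
  show "\<Gamma> \<turnstile> tame m g : X \<rightarrowtriangle> Lift i Y" unfolding tame_def using t by (intro Arr_intro) simp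
  show "X # \<Gamma> \<turnstile> App (tame m g \<up> Suc 0) (Var 0) \<equiv> forget (m \<up> Suc 0) (App (g \<up> Suc 0) (Var 0)) : Lift i (Y \<up> Suc 0)"
    unfolding tame_def using beta_weaken_Var0[OF X t] by simp
qed

text \<open>At \<open>rosoliniStructure i\<close> this is a choice of structure on every extent; at
  \<open>isRosolini i\<close> it is, up to beta, the condition truncated at each point.\<close>

abbreviation pointwise :: "tm \<Rightarrow> tm \<Rightarrow> tm \<Rightarrow> tm" where
  "pointwise D X f \<equiv> Pi X (App (D \<up> Suc 0) (Pr1 (App (f \<up> Suc 0) (Var 0))))"

lemma defined_form:
  assumes X: "\<Gamma> \<turnstile> X : U k" and f: "\<Gamma> \<turnstile> f : X \<rightarrowtriangle> Lift i Y" and D: "\<Gamma> \<turnstile> D : U i \<rightarrowtriangle> U j"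
  shows "X # \<Gamma> \<turnstile> App (f \<up> Suc 0) (Var 0) : Lift i (Y \<up> Suc 0)"
    and "X # \<Gamma> \<turnstile> Pr1 (App (f \<up> Suc 0) (Var 0)) : U i"
    and "X # \<Gamma> \<turnstile> App (D \<up> Suc 0) (Pr1 (App (f \<up> Suc 0) (Var 0))) : U j"
proof -
  show *: "X # \<Gamma> \<turnstile> App (f \<up> Suc 0) (Var 0) : Lift i (Y \<up> Suc 0)"
    using Arr_weaken_Var0[OF X f] by simp
  then show **: "X # \<Gamma> \<turnstile> Pr1 (App (f \<up> Suc 0) (Var 0)) : U i"
    unfolding Lift_def by (rule Sig_elim1)
  show "X # \<Gamma> \<turnstile> App (D \<up> Suc 0) (Pr1 (App (f \<up> Suc 0) (Var 0))) : U j"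
    by (rule Arr_elim[OF _ **]) (use weaken1[OF D ctx_cons[OF X]] in simp)
qed

text \<open>\<open>forget_path\<close> gives the path at each point. The level
  \<open>U (Suc i)\<close> of \<open>X\<close> is that of \<open>Lift i Y\<close>, because function
  extensionality wants domain and family in one universe.\<close>

lemma tame_section:
  assumes X: "\<Gamma> \<turnstile> X : U (Suc i)" and Y: "\<Gamma> \<turnstile> Y : U i" and D: "\<Gamma> \<turnstile> D : U i \<rightarrowtriangle> U j"
    and m: "\<Gamma> \<turnstile> m : propositional i D" and f: "\<Gamma> \<turnstile> f : X \<rightarrowtriangle> Lift i Y"
    and h: "\<Gamma> \<turnstile> h : pointwise D X f"
  shows "\<exists>g p. \<Gamma> \<turnstile> g : X \<rightarrowtriangle> LiftD i D Y \<and> \<Gamma> \<turnstile> p : Id (X \<rightarrowtriangle> Lift i Y) (tame m g) f"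
proof -
  note c = ctx_cons[OF X]
  let ?l = "App (f \<up> Suc 0) (Var 0)"
  \<comment> \<open>Extent and value are those of \<open>f\<close>; only the middle entry is
    new.\<close>
  let ?b = "Pr (Pr1 ?l) (Pr (App (h \<up> Suc 0) (Var 0)) (Pr2 (Pr2 ?l)))"
  have Y1: "X # \<Gamma> \<turnstile> Y \<up> Suc 0 : U i" using weaken1[OF Y c] by simp
  have D1: "X # \<Gamma> \<turnstile> D \<up> Suc 0 : U i \<rightarrowtriangle> U j" using weaken1[OF D c] by simp
  have m1: "X # \<Gamma> \<turnstile> m \<up> Suc 0 : propositional i (D \<up> Suc 0)" using weaken1[OF m c] by simp
  note l = defined_form(1)[OF X f D]
  note el = partials_elim[OF l[unfolded Lift_partials]]
  have d: "X # \<Gamma> \<turnstile> App (h \<up> Suc 0) (Var 0) : App (D \<up> Suc 0) (Pr1 ?l)"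
    by (rule App_weaken_Var0[OF X h])
  have b: "X # \<Gamma> \<turnstile> ?b : LiftD i (D \<up> Suc 0) (Y \<up> Suc 0)"
    unfolding LiftD_partials
    by (rule partials_intro(1)[OF Y1 App_Var0_form[OF D1] el(1) _ el(4)]) (use d in simp)
  let ?g = "Lam ?b"
  have g: "\<Gamma> \<turnstile> ?g : X \<rightarrowtriangle> LiftD i D Y" using b by (intro Arr_intro) simp
  note t = tame_typing[OF X Y m g]
  have e: "X # \<Gamma> \<turnstile> ?b \<equiv> App (?g \<up> Suc 0) (Var 0) : LiftD i (D \<up> Suc 0) (Y \<up> Suc 0)"
    by (rule eq_sym[OF beta_weaken_Var0[OF X b]])
  obtain q where "X # \<Gamma> \<turnstile> q : Id (Lift i (Y \<up> Suc 0)) (forget (m \<up> Suc 0) ?b) ?l"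
    using forget_path[OF Y1 D1 m1 l d] by blast
  \<comment> \<open>The path obtained starts at \<open>forget\<close> of an open tuple. Beta for
    \<open>?g\<close> under \<open>forget_cong\<close>, followed by folding \<open>tame\<close>,
    turns this start into the value of \<open>tame m ?g\<close>.\<close>
  then have q: "X # \<Gamma> \<turnstile> q : Id (Lift i (Y \<up> Suc 0)) (App (tame m ?g \<up> Suc 0) (Var 0)) ?l"
    by (rule Id_conv[OF _ eq_refl[OF Lift_form[OF Y1]] eq_trans[OF forget_cong[OF Y1 D1 m1 b e] eq_sym[OF t(3)]]
      eq_refl[OF l]])
  have "\<Gamma> \<turnstile> funext (Suc i) X (Lam (Lift i (Y \<up> Suc 0))) (tame m ?g) f (Lam q) :
      Id (Pi X (Lift i (Y \<up> Suc 0))) (tame m ?g) f"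
    by (rule funext_typing[OF X Lift_form[OF Y1] _ _ q])
      (use t(1) f in \<open>simp_all add: Arr_def\<close>)
  then have "\<Gamma> \<turnstile> funext (Suc i) X (Lam (Lift i (Y \<up> Suc 0))) (tame m ?g) f (Lam q) :
      Id (X \<rightarrowtriangle> Lift i Y) (tame m ?g) f" by (simp add: Arr_def)
  then show ?thesis using g by blast
qed

text \<open>The path is oriented so that \<open>f\<close> is the free endpoint of the induction. At
  \<open>tame m g\<close> the structure carried by \<open>g\<close> fits after a conversion, as the
  extents of \<open>tame m g\<close> and \<open>g\<close> agree judgementally.\<close>

lemma pointwise_of_tame:
  assumes X: "\<Gamma> \<turnstile> X : U k" and Y: "\<Gamma> \<turnstile> Y : U i" and D: "\<Gamma> \<turnstile> D : U i \<rightarrowtriangle> U j"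
    and m: "\<Gamma> \<turnstile> m : propositional i D" and f: "\<Gamma> \<turnstile> f : X \<rightarrowtriangle> Lift i Y"
    and g: "\<Gamma> \<turnstile> g : X \<rightarrowtriangle> LiftD i D Y" and p: "\<Gamma> \<turnstile> p : Id (X \<rightarrowtriangle> Lift i Y) (tame m g) f"
  shows "\<exists>h. \<Gamma> \<turnstile> h : pointwise D X f"
proof -
  note t = tame_typing[OF X Y m g]
  let ?A = "X \<rightarrowtriangle> Lift i Y" and ?l = "App (g \<up> Suc 0) (Var 0)"
  have A: "\<Gamma> \<turnstile> ?A : U (max k (Suc i))"
    by (intro Arr_form cumul_le[OF X] cumul_le[OF Lift_form[OF Y]]) auto
  let ?G = "Id (?A \<up> Suc 0) (tame m g \<up> Suc 0) (Var 0) # ?A # \<Gamma>"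
  note c2 = ctx_Id[OF A t(1)]
  have X2: "?G \<turnstile> X \<up> Suc (Suc 0) : U k" using weaken2[OF X c2] by simp
  have D2: "?G \<turnstile> D \<up> Suc (Suc 0) : U i \<rightarrowtriangle> U j" using weaken2[OF D c2] by simp
  have v1: "?G \<turnstile> Var (Suc 0) : X \<up> Suc (Suc 0) \<rightarrowtriangle> Lift i (Y \<up> Suc (Suc 0))"
    by (rule var_at[OF c2]) simp_all
  have T: "?G \<turnstile> pointwise (D \<up> Suc (Suc 0)) (X \<up> Suc (Suc 0)) (Var (Suc 0)) : U (max k j)"
    by (rule Pi_form[OF cumul_le[OF X2] cumul_le[OF defined_form(3)[OF X2 v1 D2]]]) auto
  note c = ctx_cons[OF X]
  have Y1: "X # \<Gamma> \<turnstile> Y \<up> Suc 0 : U i" using weaken1[OF Y c] by simp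
  have D1: "X # \<Gamma> \<turnstile> D \<up> Suc 0 : U i \<rightarrowtriangle> U j" using weaken1[OF D c] by simp
  have m1: "X # \<Gamma> \<turnstile> m \<up> Suc 0 : propositional i (D \<up> Suc 0)" using weaken1[OF m c] by simp
  have "X # \<Gamma> \<turnstile> Pr1 ?l \<equiv> Pr1 (forget (m \<up> Suc 0) ?l) : U i"
    by (rule eq_sym[OF forget_typing(2)[OF Y1 m1 t(2)]])
  moreover have "X # \<Gamma> \<turnstile> Pr1 (forget (m \<up> Suc 0) ?l) \<equiv> Pr1 (App (tame m g \<up> Suc 0) (Var 0)) : U i"
    using eq_sym[OF t(3)] unfolding Lift_def by (rule Pr1_cong)
  ultimately have "X # \<Gamma> \<turnstile> App (D \<up> Suc 0) (Pr1 ?l) \<equiv>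
      App (D \<up> Suc 0) (Pr1 (App (tame m g \<up> Suc 0) (Var 0))) : U j"
    by (rule Arr_cong[OF eq_refl[OF D1] eq_trans])
  moreover have "X # \<Gamma> \<turnstile> Pr1 (Pr2 ?l) : App (D \<up> Suc 0) (Pr1 ?l)"
    using partials_elim(3)[OF t(2)[unfolded LiftD_partials]] by simp
  ultimately have "\<Gamma> \<turnstile> Lam (Pr1 (Pr2 ?l)) : pointwise D X (tame m g)"
    by (intro Pi_intro) (rule conv)
  then have "\<Gamma> \<turnstile> J (Lam (Lam (pointwise (D \<up> Suc (Suc 0)) (X \<up> Suc (Suc 0)) (Var (Suc 0))))) (Lam (Pr1 (Pr2 ?l))) p :
      pointwise D X f"
    by (intro J_at[OF A t(1) f p T]) simp_all
  then show ?thesis by blast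
qed

section \<open>Disciplined maps and countable choice\<close>

lemma trunc_elim:
  assumes A: "\<Gamma> \<turnstile> A : U i" and B: "\<Gamma> \<turnstile> B : U j" and b: "\<Gamma> \<turnstile> b : isProp B"
    and t: "A # \<Gamma> \<turnstile> t : B \<up> Suc 0" and a: "\<Gamma> \<turnstile> a : Trunc A"
  shows "\<exists>u. \<Gamma> \<turnstile> u : B"
  using TruncRec_typing[OF A B b Arr_intro[OF t] a] by blast

lemma trunc_map:
  assumes A: "\<Gamma> \<turnstile> A : U i" and B: "\<Gamma> \<turnstile> B : U j"
    and t: "A # \<Gamma> \<turnstile> t : B \<up> Suc 0" and a: "\<Gamma> \<turnstile> a : Trunc A"
  shows "\<exists>u. \<Gamma> \<turnstile> u : Trunc B"
proof (rule trunc_elim[OF A Trunc_form[OF B] TruncProp_typing[OF B] _ a])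
  have "A # \<Gamma> \<turnstile> B \<up> Suc 0 : U j" using weaken1[OF B ctx_cons[OF A]] by simp
  from TruncIn_typing[OF this t] show "A # \<Gamma> \<turnstile> App2 (TruncIn j) (B \<up> Suc 0) t : Trunc B \<up> Suc 0" by simp
qed

lemma lift_countable_choice [simp]: "lift n k (countable_choice j) = countable_choice j"
  by (simp add: countable_choice_def)

text \<open>Choice is stated for a function from \<open>Nat\<close> to \<open>U j\<close>; beta
  conversions below the truncations connect it with an open family \<open>B\<close>.\<close>

lemma countable_choice_elim:
  assumes c: "\<Gamma> \<turnstile> c : countable_choice j" and B: "Nat # \<Gamma> \<turnstile> B : U j" and h: "\<Gamma> \<turnstile> h : Pi Nat (Trunc B)"
  shows "\<exists>t. \<Gamma> \<turnstile> t : Trunc (Pi Nat B)"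
proof -
  have N: "\<Gamma> \<turnstile> Nat : U j" by (rule cumul_le[OF Nat_form[OF typing_ctx(1)[OF c]]]) simp
  let ?B = "App (Lam B \<up> Suc 0) (Var 0)"
  have e: "Nat # \<Gamma> \<turnstile> ?B \<equiv> B : U j" by (rule beta_weaken_Var0[OF N B])
  have LB: "\<Gamma> \<turnstile> Lam B : Nat \<rightarrowtriangle> U j" using B by (intro Arr_intro) simp
  have 1: "\<Gamma> \<turnstile> App c (Lam B) : Pi Nat (Trunc ?B) \<rightarrowtriangle> Trunc (Pi Nat ?B)"
    by (rule App_at[OF c[unfolded countable_choice_def] LB]) simp
  have "\<Gamma> \<turnstile> h : Pi Nat (Trunc ?B)"
    by (rule conv[OF h Pi_cong[OF eq_refl[OF N] Trunc_cong[OF eq_sym[OF e]]]])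
  from conv[OF Arr_elim[OF 1 this] Trunc_cong[OF Pi_cong[OF eq_refl[OF N] e]]] show ?thesis by blast
qed

abbreviation disciplined_witness :: "nat \<Rightarrow> tm \<Rightarrow> tm \<Rightarrow> tm \<Rightarrow> tm \<Rightarrow> tm \<Rightarrow> tm" where
  "disciplined_witness i D m X Y f \<equiv>
     Sig (X \<rightarrowtriangle> LiftD i D Y) (Id ((X \<rightarrowtriangle> Lift i Y) \<up> 1) (tame (m \<up> 1) (Var 0)) (f \<up> 1))"

lemma lift_disciplined [simp]:
  "lift n k (disciplined i D m X Y f) = disciplined i (lift n k D) (lift n k m) (lift n k X) (lift n k Y) (lift n k f)"
  by (simp add: disciplined_def)

lemma Arr_LiftD_form:
  assumes X: "\<Gamma> \<turnstile> X : U (Suc i)" and Y: "\<Gamma> \<turnstile> Y : U i" and D: "\<Gamma> \<turnstile> D : U i \<rightarrowtriangle> U j"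
  shows "\<Gamma> \<turnstile> X \<rightarrowtriangle> LiftD i D Y : U (max (Suc i) j)"
  by (intro Arr_form cumul_le[OF X] LiftD_form[OF Y D]) simp

text \<open>Both orientations occur: \<open>disciplined\<close> has the tame map on the left of its
  identity type, \<open>factors_through_Rosolini\<close> has it on the right.\<close>

lemma tame_Id_form:
  assumes X: "\<Gamma> \<turnstile> X : U (Suc i)" and Y: "\<Gamma> \<turnstile> Y : U i" and D: "\<Gamma> \<turnstile> D : U i \<rightarrowtriangle> U j"
    and m: "\<Gamma> \<turnstile> m : propositional i D" and f: "\<Gamma> \<turnstile> f : X \<rightarrowtriangle> Lift i Y"
  shows "X \<rightarrowtriangle> LiftD i D Y # \<Gamma> \<turnstile> Id ((X \<rightarrowtriangle> Lift i Y) \<up> 1) (tame (m \<up> 1) (Var 0)) (f \<up> 1) : U (max (Suc i) j)"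
    and "X \<rightarrowtriangle> LiftD i D Y # \<Gamma> \<turnstile> Id ((X \<rightarrowtriangle> Lift i Y) \<up> 1) (f \<up> 1) (tame (m \<up> 1) (Var 0)) : U (max (Suc i) j)"
proof -
  note c = ctx_cons[OF Arr_LiftD_form[OF X Y D]]
  let ?G = "X \<rightarrowtriangle> LiftD i D Y # \<Gamma>"
  have X1: "?G \<turnstile> X \<up> Suc 0 : U (Suc i)" using weaken1[OF X c] by simp
  have Y1: "?G \<turnstile> Y \<up> Suc 0 : U i" using weaken1[OF Y c] by simp
  have m1: "?G \<turnstile> m \<up> Suc 0 : propositional i (D \<up> Suc 0)" using weaken1[OF m c] by simp
  have f1: "?G \<turnstile> f \<up> Suc 0 : X \<up> Suc 0 \<rightarrowtriangle> Lift i (Y \<up> Suc 0)" using weaken1[OF f c] by simp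
  have v: "?G \<turnstile> Var 0 : X \<up> Suc 0 \<rightarrowtriangle> LiftD i (D \<up> Suc 0) (Y \<up> Suc 0)" by (rule var_at[OF c]) simp_all
  note t = tame_typing(1)[OF X1 Y1 m1 v]
  have A: "?G \<turnstile> X \<up> Suc 0 \<rightarrowtriangle> Lift i (Y \<up> Suc 0) : U (max (Suc i) j)"
    by (rule cumul_le[OF Arr_form[OF X1 Lift_form[OF Y1]]]) simp
  show "?G \<turnstile> Id ((X \<rightarrowtriangle> Lift i Y) \<up> 1) (tame (m \<up> 1) (Var 0)) (f \<up> 1) : U (max (Suc i) j)"
    "?G \<turnstile> Id ((X \<rightarrowtriangle> Lift i Y) \<up> 1) (f \<up> 1) (tame (m \<up> 1) (Var 0)) : U (max (Suc i) j)"
    using Id_form[OF A t f1] Id_form[OF A f1 t] by simp_all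
qed

lemma disciplined_form:
  assumes "\<Gamma> \<turnstile> X : U (Suc i)" "\<Gamma> \<turnstile> Y : U i" "\<Gamma> \<turnstile> D : U i \<rightarrowtriangle> U j"
    "\<Gamma> \<turnstile> m : propositional i D" "\<Gamma> \<turnstile> f : X \<rightarrowtriangle> Lift i Y"
  shows "\<Gamma> \<turnstile> disciplined_witness i D m X Y f : U (max (Suc i) j)"
    and "\<Gamma> \<turnstile> disciplined i D m X Y f : U (max (Suc i) j)"
  unfolding disciplined_def
  by (intro Trunc_form Sig_form Arr_LiftD_form tame_Id_form assms)+

text \<open>The truncation can be eliminated because the target is a product of truncations, a
  proposition by \<open>isProp_Pi\<close>. \<open>X\<close> is used at two levels:
  \<open>U (Suc i)\<close> for the maps into \<open>Lift i Y\<close>, and \<open>U j\<close> for the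
  product over the truncated values of \<open>D\<close>.\<close>

lemma disciplined_imp_trunc:
  assumes X: "\<Gamma> \<turnstile> X : U (Suc i)" "\<Gamma> \<turnstile> X : U j" and Y: "\<Gamma> \<turnstile> Y : U i" and D: "\<Gamma> \<turnstile> D : U i \<rightarrowtriangle> U j"
    and m: "\<Gamma> \<turnstile> m : propositional i D" and f: "\<Gamma> \<turnstile> f : X \<rightarrowtriangle> Lift i Y"
    and s: "\<Gamma> \<turnstile> s : disciplined i D m X Y f"
  shows "\<exists>h. \<Gamma> \<turnstile> h : Pi X (Trunc (App (D \<up> Suc 0) (Pr1 (App (f \<up> Suc 0) (Var 0)))))"
proof -
  note W = disciplined_form(1)[OF X(1) Y D m f]
  note Q = defined_form(3)[OF X(1) f D]
  note B = Pi_form[OF X(2) Trunc_form[OF Q]]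
  obtain b where b: "\<Gamma> \<turnstile> b : isProp (Pi X (Trunc (App (D \<up> Suc 0) (Pr1 (App (f \<up> Suc 0) (Var 0))))))"
    using isProp_Pi[OF X(2) Trunc_form[OF Q] TruncProp_typing[OF Q]] by blast
  note c = ctx_cons[OF W]
  let ?W = "disciplined_witness i D m X Y f"
  let ?G = "?W # \<Gamma>"
  have X1: "?G \<turnstile> X \<up> Suc 0 : U (Suc i)" using weaken1[OF X(1) c] by simp
  have Y1: "?G \<turnstile> Y \<up> Suc 0 : U i" using weaken1[OF Y c] by simp
  have D1: "?G \<turnstile> D \<up> Suc 0 : U i \<rightarrowtriangle> U j" using weaken1[OF D c] by simp
  have m1: "?G \<turnstile> m \<up> Suc 0 : propositional i (D \<up> Suc 0)" using weaken1[OF m c] by simp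
  have f1: "?G \<turnstile> f \<up> Suc 0 : X \<up> Suc 0 \<rightarrowtriangle> Lift i (Y \<up> Suc 0)" using weaken1[OF f c] by simp
  have v: "?G \<turnstile> Var 0 : ?W \<up> Suc 0" by (rule var_at[OF c]) simp_all
  have g: "?G \<turnstile> Pr1 (Var 0) : X \<up> Suc 0 \<rightarrowtriangle> LiftD i (D \<up> Suc 0) (Y \<up> Suc 0)"
    using Sig_elim1[OF v[unfolded lift.simps]] by simp
  have p: "?G \<turnstile> Pr2 (Var 0) : Id (X \<up> Suc 0 \<rightarrowtriangle> Lift i (Y \<up> Suc 0)) (tame (m \<up> Suc 0) (Pr1 (Var 0))) (f \<up> Suc 0)"
    using Sig_elim2[OF v[unfolded lift.simps]] by simp
  obtain h where h: "?G \<turnstile> h : pointwise (D \<up> Suc 0) (X \<up> Suc 0) (f \<up> Suc 0)"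
    using pointwise_of_tame[OF X1 Y1 D1 m1 f1 g p] by blast
  have "?G \<turnstile> Lam (App2 (TruncIn j) (App (D \<up> Suc (Suc 0)) (Pr1 (App (f \<up> Suc (Suc 0)) (Var 0)))) (App (h \<up> Suc 0) (Var 0))) :
     Pi X (Trunc (App (D \<up> Suc 0) (Pr1 (App (f \<up> Suc 0) (Var 0))))) \<up> Suc 0"
    using Pi_intro[OF TruncIn_typing[OF defined_form(3)[OF X1 f1 D1] App_weaken_Var0[OF X1 h]]] by simp
  from trunc_elim[OF W B b this s[unfolded disciplined_def]] show ?thesis by blast
qed

text \<open>\<open>tame_section\<close> applied below a truncation that already stands outside the
  product. This works over any domain; for \<open>Nat\<close>, producing such a truncated element
  from truncations at each point is the task of choice.\<close>

lemma disciplined_of_trunc: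
  assumes X: "\<Gamma> \<turnstile> X : U (Suc i)" and Y: "\<Gamma> \<turnstile> Y : U i" and D: "\<Gamma> \<turnstile> D : U i \<rightarrowtriangle> U j"
    and m: "\<Gamma> \<turnstile> m : propositional i D" and f: "\<Gamma> \<turnstile> f : X \<rightarrowtriangle> Lift i Y"
    and a: "\<Gamma> \<turnstile> a : Trunc (pointwise D X f)"
  shows "\<exists>t. \<Gamma> \<turnstile> t : disciplined i D m X Y f"
proof -
  have B: "\<Gamma> \<turnstile> pointwise D X f : U (max (Suc i) j)"
    by (intro Pi_form cumul_le[OF X] cumul_le[OF defined_form(3)[OF X f D]]) auto
  note c = ctx_cons[OF B]
  let ?G = "pointwise D X f # \<Gamma>"
  have X1: "?G \<turnstile> X \<up> Suc 0 : U (Suc i)" using weaken1[OF X c] by simp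
  have Y1: "?G \<turnstile> Y \<up> Suc 0 : U i" using weaken1[OF Y c] by simp
  have D1: "?G \<turnstile> D \<up> Suc 0 : U i \<rightarrowtriangle> U j" using weaken1[OF D c] by simp
  have m1: "?G \<turnstile> m \<up> Suc 0 : propositional i (D \<up> Suc 0)" using weaken1[OF m c] by simp
  have f1: "?G \<turnstile> f \<up> Suc 0 : X \<up> Suc 0 \<rightarrowtriangle> Lift i (Y \<up> Suc 0)" using weaken1[OF f c] by simp
  have v: "?G \<turnstile> Var 0 : pointwise (D \<up> Suc 0) (X \<up> Suc 0) (f \<up> Suc 0)" by (rule var_at[OF c]) simp_all
  obtain g p where g: "?G \<turnstile> g : X \<up> Suc 0 \<rightarrowtriangle> LiftD i (D \<up> Suc 0) (Y \<up> Suc 0)"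
    and p: "?G \<turnstile> p : Id (X \<up> Suc 0 \<rightarrowtriangle> Lift i (Y \<up> Suc 0)) (tame (m \<up> Suc 0) g) (f \<up> Suc 0)"
    using tame_section[OF X1 Y1 D1 m1 f1 v] by blast
  have "?G \<turnstile> Pr g p : disciplined_witness i D m X Y f \<up> Suc 0"
    using Sig_intro[OF g tame_Id_form(1)[OF X1 Y1 D1 m1 f1]] p by simp
  from trunc_map[OF B disciplined_form(1)[OF X Y D m f] this a] show ?thesis unfolding disciplined_def .
qed

section \<open>Formation of the types bound in the theorem\<close>

lemma propositional_form:
  assumes D: "\<Gamma> \<turnstile> D : U i \<rightarrowtriangle> U j" shows "\<Gamma> \<turnstile> propositional i D : U (max (Suc i) j)"
  unfolding propositional_def
  by (intro Pi_form Arr_form cumul_le[OF App_Var0_form[OF D]] cumul_le[OF isProp_Var0_form]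
    cumul_le[OF univ] typing_ctx(1)[OF D]) auto

text \<open>Extending a context by a dominance requires its type to lie in some universe. The level
  covers both the quantification over \<open>U i\<close> and the values of \<open>D\<close>.\<close>

lemma structural_dominance_form:
  assumes D: "\<Gamma> \<turnstile> D : U i \<rightarrowtriangle> U j" shows "\<Gamma> \<turnstile> structural_dominance i D : U (max (Suc i) j)"
proof -
  let ?K = "max (Suc i) j"
  note c = typing_ctx(1)[OF D]
  have Unit: "\<Gamma> \<turnstile> App D Unit : U ?K"
    by (rule cumul_le[OF Arr_elim[OF D cumul_le[OF Unit_form[OF c]]]]) auto
  let ?F = "Var 0 \<rightarrowtriangle> U i"
  let ?G1 = "U i # \<Gamma>" let ?G2 = "?F # ?G1" let ?G3 = "Var (Suc 0) # ?G2"
  have U: "\<Gamma> \<turnstile> U i : U ?K" by (rule cumul_le[OF univ[OF c]]) simp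
  note c1 = ctx_cons[OF U]
  have F: "?G1 \<turnstile> ?F : U ?K"
    by (rule Arr_form[OF cumul_le[of _ _ i] cumul_le[OF univ[OF c1]]]) (auto intro: var_at c1)
  note c2 = ctx_cons[OF F]
  have P: "?G2 \<turnstile> Var (Suc 0) : U i" by (intro var_at c2) auto
  have Q: "?G2 \<turnstile> Var 0 : Var (Suc 0) \<rightarrowtriangle> U i" by (intro var_at c2) auto
  note c3 = ctx_cons[OF P]
  have Q0: "?G3 \<turnstile> App (Var (Suc 0)) (Var 0) : U i"
    using Arr_weaken_Var0[OF P Q] by simp
  have D2: "?G2 \<turnstile> D \<up> Suc (Suc 0) : U i \<rightarrowtriangle> U j" using weaken2[OF D c2] by simp
  have D3: "?G3 \<turnstile> D \<up> Suc (Suc (Suc 0)) : U i \<rightarrowtriangle> U j" using weaken1[OF D2 c3] by simp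
  have closed: "?G2 \<turnstile> App (D \<up> Suc (Suc 0)) (Var (Suc 0))
        \<rightarrowtriangle> Pi (Var (Suc 0)) (App (D \<up> Suc (Suc (Suc 0))) (App (Var (Suc 0)) (Var 0)))
        \<rightarrowtriangle> App (D \<up> Suc (Suc 0)) (Sig (Var (Suc 0)) (App (Var (Suc 0)) (Var 0))) : U ?K"
    by (intro Arr_form Pi_form cumul_le[OF Arr_elim[OF D2 P]] cumul_le[OF P] cumul_le[OF Arr_elim[OF D3 Q0]]
      cumul_le[OF Arr_elim[OF D2 Sig_form[OF P Q0]]]) auto
  have "structural_dominance i D = propositional i D \<otimes> App D Unit \<otimes> Pi (U i) (Pi ?F
      (App (D \<up> Suc (Suc 0)) (Var (Suc 0))
        \<rightarrowtriangle> Pi (Var (Suc 0)) (App (D \<up> Suc (Suc (Suc 0))) (App (Var (Suc 0)) (Var 0)))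
        \<rightarrowtriangle> App (D \<up> Suc (Suc 0)) (Sig (Var (Suc 0)) (App (Var (Suc 0)) (Var 0)))))"
    by (simp add: structural_dominance_def propositional_def eval_nat_numeral)
  then show ?thesis
    using Prod_form[OF propositional_form[OF D] Prod_form[OF Unit Pi_form[OF U Pi_form[OF F closed]]]] by simp
qed

lemma countable_choice_form:
  assumes c: "ctx \<Gamma>" shows "\<Gamma> \<turnstile> countable_choice j : U (Suc j)"
proof -
  have N: "\<Delta> \<turnstile> Nat : U k" if "ctx \<Delta>" for \<Delta> k by (rule cumul_le[OF Nat_form[OF that]]) simp
  have F: "\<Gamma> \<turnstile> Nat \<rightarrowtriangle> U j : U (Suc j)" by (rule Arr_form[OF N[OF c] univ[OF c]])
  note c1 = ctx_cons[OF F]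
  let ?G = "Nat \<rightarrowtriangle> U j # \<Gamma>"
  have v: "?G \<turnstile> Var 0 : Nat \<rightarrowtriangle> U j" by (rule var_at[OF c1]) simp_all
  have "Nat # ?G \<turnstile> App (Var (Suc 0)) (Var 0) : U j"
    using Arr_weaken_Var0[OF N[OF c1, of 0] v] by simp
  then have "?G \<turnstile> Pi Nat (Trunc (App (Var (Suc 0)) (Var 0))) \<rightarrowtriangle> Trunc (Pi Nat (App (Var (Suc 0)) (Var 0))) : U (Suc j)"
    by (intro cumul[of _ _ j] Arr_form Pi_form Trunc_form N[OF c1])
  then show ?thesis unfolding countable_choice_def using Pi_form[OF F] by simp
qed

lemma Nat_typing: "ctx \<Gamma> \<Longrightarrow> \<Gamma> \<turnstile> Nat : U k"
  by (rule cumul_le[OF Nat_form]) simp_all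

text \<open>Choice enters in the implication from right to left, at the level \<open>j\<close> in
  which \<open>D\<close> takes its values.\<close>

lemma disciplined_iff_trunc:
  assumes D: "\<Gamma> \<turnstile> D : U i \<rightarrowtriangle> U j" and m: "\<Gamma> \<turnstile> m : propositional i D"
    and f: "\<Gamma> \<turnstile> f : Nat \<rightarrowtriangle> Lift i Nat" and cc: "\<Gamma> \<turnstile> c : countable_choice j"
  shows "\<exists>t. \<Gamma> \<turnstile> t : disciplined i D m Nat Nat f \<leftrightharpoons> Pi Nat (Trunc (App (D \<up> Suc 0) (Pr1 (App (f \<up> Suc 0) (Var 0)))))"
proof -
  let ?A = "disciplined i D m Nat Nat f"
  let ?B = "Pi Nat (Trunc (App (D \<up> Suc 0) (Pr1 (App (f \<up> Suc 0) (Var 0)))))"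
  note N = Nat_typing[OF typing_ctx(1)[OF D]]
  have A: "\<Gamma> \<turnstile> ?A : U (max (Suc i) j)" by (rule disciplined_form(2)[OF N N D m f])
  have B: "\<Gamma> \<turnstile> ?B : U (max (Suc i) j)"
    by (rule cumul_le[OF Pi_form[OF N Trunc_form[OF defined_form(3)[OF N f D]]]]) simp
  note cA = ctx_cons[OF A] and cB = ctx_cons[OF B]
  note NA = Nat_typing[OF cA] and NB = Nat_typing[OF cB]
  have DA: "?A # \<Gamma> \<turnstile> D \<up> Suc 0 : U i \<rightarrowtriangle> U j" using weaken1[OF D cA] by simp
  have mA: "?A # \<Gamma> \<turnstile> m \<up> Suc 0 : propositional i (D \<up> Suc 0)" using weaken1[OF m cA] by simp
  have fA: "?A # \<Gamma> \<turnstile> f \<up> Suc 0 : Nat \<rightarrowtriangle> Lift i Nat" using weaken1[OF f cA] by simp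
  have "?A # \<Gamma> \<turnstile> Var 0 : disciplined i (D \<up> Suc 0) (m \<up> Suc 0) Nat Nat (f \<up> Suc 0)"
    by (rule var_at[OF cA]) simp_all
  from disciplined_imp_trunc[OF NA NA NA DA mA fA this]
  obtain h where "?A # \<Gamma> \<turnstile> h : ?B \<up> Suc 0" by auto
  then have h: "\<Gamma> \<turnstile> Lam h : ?A \<rightarrowtriangle> ?B" by (rule Arr_intro)
  have DB: "?B # \<Gamma> \<turnstile> D \<up> Suc 0 : U i \<rightarrowtriangle> U j" using weaken1[OF D cB] by simp
  have mB: "?B # \<Gamma> \<turnstile> m \<up> Suc 0 : propositional i (D \<up> Suc 0)" using weaken1[OF m cB] by simp
  have fB: "?B # \<Gamma> \<turnstile> f \<up> Suc 0 : Nat \<rightarrowtriangle> Lift i Nat" using weaken1[OF f cB] by simp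
  have ccB: "?B # \<Gamma> \<turnstile> c \<up> Suc 0 : countable_choice j" using weaken1[OF cc cB] by simp
  have "?B # \<Gamma> \<turnstile> Var 0 :
      Pi Nat (Trunc (App ((D \<up> Suc 0) \<up> Suc 0) (Pr1 (App ((f \<up> Suc 0) \<up> Suc 0) (Var 0)))))"
    by (rule var_at[OF cB]) simp_all
  \<comment> \<open>Here the truncation moves out of the product over \<open>Nat\<close>.\<close>
  from countable_choice_elim[OF ccB defined_form(3)[OF NB fB DB] this]
  obtain a where "?B # \<Gamma> \<turnstile> a : Trunc (pointwise (D \<up> Suc 0) Nat (f \<up> Suc 0))" by blast
  from disciplined_of_trunc[OF NB NB DB mB fB this]
  obtain k where "?B # \<Gamma> \<turnstile> k : ?A \<up> Suc 0" by auto
  then have "\<Gamma> \<turnstile> Lam k : ?B \<rightarrowtriangle> ?A" by (rule Arr_intro)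
  from Iff_intro[OF A B h this] show ?thesis by blast
qed

section \<open>Rosolini propositions\<close>

lemma lift_angle [simp]: "lift n k (angle a) = angle (lift n k a)"
  by (simp add: angle_def)

lemma subst_angle [simp]: "subst k s (angle a) = angle (subst k s a)"
  by (simp add: angle_def)

lemma lift_Nat_inf [simp]: "lift n k Nat_inf = Nat_inf"
  by (simp add: Nat_inf_def)

lemma subst_Nat_inf [simp]: "subst k s Nat_inf = Nat_inf"
  by (simp add: Nat_inf_def)

lemma lift_rosoliniStructure [simp]: "lift n k (rosoliniStructure i) = rosoliniStructure i"
  by (simp add: rosoliniStructure_def)

lemma subst_rosoliniStructure [simp]: "subst k s (rosoliniStructure i) = rosoliniStructure i"
  by (simp add: rosoliniStructure_def)

lemma lift_isRosolini [simp]: "lift n k (isRosolini i) = isRosolini i"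
  by (simp add: isRosolini_def)

lemma lift_rosoliniStructure_isProp [simp]: "lift n k rosoliniStructure_isProp = rosoliniStructure_isProp"
  by (simp add: rosoliniStructure_isProp_def eval_nat_numeral)

lemma subst_rosoliniStructure_isProp [simp]: "subst k s rosoliniStructure_isProp = rosoliniStructure_isProp"
  by (simp add: rosoliniStructure_isProp_def eval_nat_numeral)

lemma lift_isRosolini_isProp [simp]: "lift n k (isRosolini_isProp i) = isRosolini_isProp i"
  by (simp add: isRosolini_isProp_def isProp_isProp_def prop_set_def eval_nat_numeral)

lemma subst_isRosolini_isProp [simp]: "subst k s (isRosolini_isProp i) = isRosolini_isProp i"
  by (simp add: isRosolini_isProp_def isProp_isProp_def prop_set_def eval_nat_numeral)

text \<open>\<open>Nat\<close> and \<open>Two\<close> lie in \<open>U 0\<close>, so by cumulativity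
  this type can be compared with an extent in any \<open>U i\<close>, as the identity type in
  \<open>rosoliniStructure i\<close> demands.\<close>

lemma angle_form:
  assumes a: "\<Gamma> \<turnstile> a : Nat \<rightarrowtriangle> Two" shows "\<Gamma> \<turnstile> angle a : U k"
proof (rule cumul_le[of _ _ 0])
  have c: "ctx \<Gamma>" using a by (rule typing_ctx)
  have N: "\<Gamma> \<turnstile> Nat : U 0" by (rule Nat_form[OF c])
  note c1 = ctx_cons[OF N]
  show "\<Gamma> \<turnstile> angle a : U 0" unfolding angle_def
    using Arr_weaken_Var0[OF N a] by (intro Sig_form N Id_form Two_form Two_intro1 c1) simp
qed simp

lemma Nat_inf_form:
  assumes c: "ctx \<Gamma>" shows "\<Gamma> \<turnstile> Nat_inf : U k"
proof (rule cumul_le[of _ _ 0])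
  have A: "\<Gamma> \<turnstile> Nat \<rightarrowtriangle> Two : U 0" by (intro Arr_form Nat_form Two_form c)
  note c1 = ctx_cons[OF A]
  have "Nat \<rightarrowtriangle> Two # \<Gamma> \<turnstile> Var 0 : Nat \<rightarrowtriangle> Two" by (rule var_at[OF c1]) (simp_all)
  then show "\<Gamma> \<turnstile> Nat_inf : U 0" unfolding Nat_inf_def
    by (intro Sig_form A isProp_form angle_form)
qed simp

lemma Nat_inf_elim:
  assumes u: "\<Gamma> \<turnstile> u : Nat_inf"
  shows "\<Gamma> \<turnstile> Pr1 u : Nat \<rightarrowtriangle> Two" "\<Gamma> \<turnstile> Pr2 u : isProp (angle (Pr1 u))"
  using Sig_elim1[OF u[unfolded Nat_inf_def]] Sig_elim2[OF u[unfolded Nat_inf_def]] by simp_all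

lemma Nat_inf_Var0:
  assumes "ctx \<Gamma>" shows "Nat_inf # \<Gamma> \<turnstile> angle (Pr1 (Var 0)) : U k"
  by (intro angle_form Nat_inf_elim(1) var_at ctx_cons[OF Nat_inf_form[OF assms, of 0]]) simp_all

abbreviation rosolini_body :: "nat \<Rightarrow> tm \<Rightarrow> tm" where
  "rosolini_body i P \<equiv> Id (U i) (P \<up> Suc 0) (angle (Pr1 (Var 0)))"

lemma rosolini_body_form:
  assumes P: "\<Gamma> \<turnstile> P : U i" shows "Nat_inf # \<Gamma> \<turnstile> rosolini_body i P : U (Suc i)"
proof -
  note c = typing_ctx(1)[OF P]
  note c1 = ctx_cons[OF Nat_inf_form[OF c, of 0]]
  show ?thesis using weaken1[OF P c1] by (intro Id_form univ c1 Nat_inf_Var0[OF c]) simp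
qed

lemma rosolini_Sig_form: "\<Gamma> \<turnstile> P : U i \<Longrightarrow> \<Gamma> \<turnstile> Sig Nat_inf (rosolini_body i P) : U (Suc i)"
  by (intro Sig_form Nat_inf_form rosolini_body_form typing_ctx(1))

lemma Var0_U: "ctx \<Gamma> \<Longrightarrow> U i # \<Gamma> \<turnstile> Var 0 : U i"
  by (rule var_at[OF ctx_cons[OF univ]]) simp_all

lemma rosoliniStructure_typing:
  assumes "ctx \<Gamma>" shows "\<Gamma> \<turnstile> rosoliniStructure i : U i \<rightarrowtriangle> U (Suc i)"
  unfolding rosoliniStructure_def
  using rosolini_Sig_form[OF Var0_U[OF assms]] by (intro Arr_intro) simp

lemma rosoliniStructure_App:
  assumes P: "\<Gamma> \<turnstile> P : U i"
  shows "\<Gamma> \<turnstile> App (rosoliniStructure i) P \<equiv> Sig Nat_inf (rosolini_body i P) : U (Suc i)"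
  unfolding rosoliniStructure_def One_nat_def
  by (rule beta_at[OF rosolini_Sig_form[OF Var0_U[OF typing_ctx(1)[OF P], of i], simplified] P]) simp_all

lemma isRosolini_typing:
  assumes "ctx \<Gamma>" shows "\<Gamma> \<turnstile> isRosolini i : U i \<rightarrowtriangle> U (Suc i)"
  unfolding isRosolini_def
  using Trunc_form[OF App_Var0_form[OF rosoliniStructure_typing[OF assms]]] by (intro Arr_intro) simp

lemma isRosolini_App:
  assumes P: "\<Gamma> \<turnstile> P : U i"
  shows "\<Gamma> \<turnstile> App (isRosolini i) P \<equiv> Trunc (App (rosoliniStructure i) P) : U (Suc i)"
  unfolding isRosolini_def
  by (rule beta_at[OF Trunc_form[OF App_Var0_form[OF rosoliniStructure_typing[OF typing_ctx(1)[OF P], of i],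
      simplified]] P]) simp_all

lemma rosoliniStructure_elim:
  assumes P: "\<Gamma> \<turnstile> P : U i" and s: "\<Gamma> \<turnstile> s : App (rosoliniStructure i) P"
  shows "\<Gamma> \<turnstile> Pr1 s : Nat_inf" "\<Gamma> \<turnstile> Pr2 s : Id (U i) P (angle (Pr1 (Pr1 s)))"
proof -
  have s': "\<Gamma> \<turnstile> s : Sig Nat_inf (rosolini_body i P)" by (rule conv[OF s rosoliniStructure_App[OF P]])
  show "\<Gamma> \<turnstile> Pr1 s : Nat_inf" "\<Gamma> \<turnstile> Pr2 s : Id (U i) P (angle (Pr1 (Pr1 s)))"
    using Sig_elim1[OF s'] Sig_elim2[OF s'] by simp_all
qed

text \<open>The given path leads from \<open>P\<close> to an \<open>angle\<close> that is known to
  be a proposition. The motive is an implication from the endpoint back to \<open>P\<close>, so path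
  induction starts at the identity function and no inverse path is formed.\<close>

lemma rosoliniStructure_isProp_typing:
  assumes c: "ctx \<Gamma>" shows "\<Gamma> \<turnstile> rosoliniStructure_isProp : propositional i (rosoliniStructure i)"
proof -
  let ?S = "App (rosoliniStructure i) (Var 0)" let ?G = "?S # U i # \<Gamma>"
  have S: "U i # \<Gamma> \<turnstile> ?S : U (Suc i)" using App_Var0_form[OF rosoliniStructure_typing[OF c]] by simp
  note c2 = ctx_cons[OF S]
  have P: "?G \<turnstile> Var 1 : U i" by (rule var_at[OF c2]) simp_all
  have s: "?G \<turnstile> Var 0 : App (rosoliniStructure i) (Var 1)" by (rule var_at[OF c2]) simp_all
  note e = rosoliniStructure_elim[OF P s]
  note u = Nat_inf_elim[OF e(1)]
  note a = angle_form[OF u(1), of i]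
  note A = univ[OF c2, of i]
  note c4 = ctx_Id[OF A P]
  let ?H = "Id (U i \<up> Suc 0) (Var 1 \<up> Suc 0) (Var 0) # U i # ?G"
  \<comment> \<open>Over \<open>?H\<close>, \<open>Var 1\<close> is the free endpoint and
    \<open>Var 3\<close> the original type.\<close>
  have T: "?H \<turnstile> isProp (Var 1) \<rightarrowtriangle> isProp (Var 3) : U i"
    by (intro Arr_form isProp_form var_at c4) (simp_all add: eval_nat_numeral)
  have "?G \<turnstile> Lam (Var 0) : isProp (Var 1) \<rightarrowtriangle> isProp (Var 1)"
    by (intro Arr_intro var_at ctx_cons[OF isProp_form[OF P]]) simp_all
  then have "?G \<turnstile> J (Lam (Lam (isProp (Var 1) \<rightarrowtriangle> isProp (Var 3)))) (Lam (Var 0)) (Pr2 (Var 0)) :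
      isProp (angle (Pr1 (Pr1 (Var 0)))) \<rightarrowtriangle> isProp (Var 1)"
    by (intro J_at[OF A P a e(2) T]) (simp_all add: eval_nat_numeral)
  from Arr_elim[OF this u(2)]
  show ?thesis unfolding rosoliniStructure_isProp_def propositional_def
    by (intro Pi_intro Arr_intro) simp
qed

lemma isRosolini_isProp_typing:
  assumes c: "ctx \<Gamma>" shows "\<Gamma> \<turnstile> isRosolini_isProp i : propositional i (isRosolini i)"
proof -
  let ?S = "App (isRosolini i) (Var 0)" let ?G = "?S # U i # \<Gamma>"
  have S: "U i # \<Gamma> \<turnstile> ?S : U (Suc i)" using App_Var0_form[OF isRosolini_typing[OF c]] by simp
  note c2 = ctx_cons[OF S]
  have P: "?G \<turnstile> Var 1 : U i" by (rule var_at[OF c2]) simp_all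
  have "?G \<turnstile> Var 0 : App (isRosolini i) (Var 1)" by (rule var_at[OF c2]) simp_all
  then have s: "?G \<turnstile> Var 0 : Trunc (App (rosoliniStructure i) (Var 1))"
    by (rule conv[OF _ isRosolini_App[OF P]])
  have R: "?G \<turnstile> App (rosoliniStructure i) (Var 1) : U (Suc i)"
    by (rule Arr_elim[OF rosoliniStructure_typing[OF c2] P])
  have r: "?G \<turnstile> App rosoliniStructure_isProp (Var 1) : App (rosoliniStructure i) (Var 1) \<rightarrowtriangle> isProp (Var 1)"
    by (rule App_at[OF rosoliniStructure_isProp_typing[OF c2, unfolded propositional_def] P]) simp
  from TruncRec_typing[OF R isProp_form[OF P] isProp_isProp_typing[OF P] r s]
  show ?thesis unfolding isRosolini_isProp_def propositional_def
    by (intro Pi_intro Arr_intro) simp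
qed

text \<open>Countable choice is only available in \<open>U i\<close>, while \<open>rosoliniStructure i\<close> takes values in
  \<open>U (Suc i)\<close> because it mentions an identity type of \<open>U i\<close>. By propositional extensionality that
  identity type can be replaced by a logical equivalence, which lives in \<open>U i\<close>.\<close>

definition small_rosolini :: "tm \<Rightarrow> tm" where
  "small_rosolini P = Sig Nat_inf ((P \<up> Suc 0 \<rightarrowtriangle> angle (Pr1 (Var 0))) \<otimes> (angle (Pr1 (Var 0)) \<rightarrowtriangle> P \<up> Suc 0))"

lemma lift_small_rosolini [simp]: "lift n k (small_rosolini P) = small_rosolini (lift n k P)"
  by (simp add: small_rosolini_def)

lemma small_rosolini_body_form:
  assumes P: "\<Gamma> \<turnstile> P : U i"
  shows "Nat_inf # \<Gamma> \<turnstile> (P \<up> Suc 0 \<rightarrowtriangle> angle (Pr1 (Var 0))) \<otimes> (angle (Pr1 (Var 0)) \<rightarrowtriangle> P \<up> Suc 0) : U i"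
proof -
  note c = typing_ctx(1)[OF P]
  have "Nat_inf # \<Gamma> \<turnstile> P \<up> Suc 0 : U i" using weaken1[OF P ctx_cons[OF Nat_inf_form[OF c, of 0]]] by simp
  then show ?thesis by (intro Prod_form Arr_form Nat_inf_Var0[OF c])
qed

lemma small_rosolini_form:
  assumes P: "\<Gamma> \<turnstile> P : U i" shows "\<Gamma> \<turnstile> small_rosolini P : U i"
  unfolding small_rosolini_def
  by (rule Sig_form[OF Nat_inf_form[OF typing_ctx(1)[OF P]] small_rosolini_body_form[OF P]])

text \<open>Two path inductions on the same path, with the free endpoint once as codomain and once
  as domain; both start from the identity function.\<close>

lemma transport_along:
  assumes P: "\<Gamma> \<turnstile> P : U i" and Q: "\<Gamma> \<turnstile> Q : U i" and p: "\<Gamma> \<turnstile> p : Id (U i) P Q"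
  shows "\<exists>f. \<Gamma> \<turnstile> f : P \<rightarrowtriangle> Q" and "\<exists>g. \<Gamma> \<turnstile> g : Q \<rightarrowtriangle> P"
proof -
  note A = univ[OF typing_ctx(1)[OF P], of i]
  note c = ctx_Id[OF A P]
  let ?G = "Id (U i \<up> Suc 0) (P \<up> Suc 0) (Var 0) # U i # \<Gamma>"
  have P2: "?G \<turnstile> P \<up> Suc (Suc 0) : U i" using weaken2[OF P c] by simp
  have v: "?G \<turnstile> Var (Suc 0) : U i" by (rule var_at[OF c]) simp_all
  have id: "\<Gamma> \<turnstile> Lam (Var 0) : P \<rightarrowtriangle> P" by (intro Arr_intro var_at ctx_cons[OF P]) simp_all
  show "\<exists>f. \<Gamma> \<turnstile> f : P \<rightarrowtriangle> Q"
    by (rule exI, rule J_at[OF A P Q p Arr_form[OF P2 v], where d = "Lam (Var 0)"]) (simp_all add: id)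
  show "\<exists>g. \<Gamma> \<turnstile> g : Q \<rightarrowtriangle> P"
    by (rule exI, rule J_at[OF A P Q p Arr_form[OF v P2], where d = "Lam (Var 0)"]) (simp_all add: id)
qed

lemma small_of_rosoliniStructure:
  assumes P: "\<Gamma> \<turnstile> P : U i" and s: "\<Gamma> \<turnstile> s : App (rosoliniStructure i) P"
  shows "\<exists>t. \<Gamma> \<turnstile> t : small_rosolini P"
proof -
  note e = rosoliniStructure_elim[OF P s]
  note Q = angle_form[OF Nat_inf_elim(1)[OF e(1)], of i]
  obtain f g where f: "\<Gamma> \<turnstile> f : P \<rightarrowtriangle> angle (Pr1 (Pr1 s))" and g: "\<Gamma> \<turnstile> g : angle (Pr1 (Pr1 s)) \<rightarrowtriangle> P"
    using transport_along[OF P Q e(2)] by blast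
  have "\<Gamma> \<turnstile> Pr f g : inst ((P \<up> Suc 0 \<rightarrowtriangle> angle (Pr1 (Var 0))) \<otimes> (angle (Pr1 (Var 0)) \<rightarrowtriangle> P \<up> Suc 0)) (Pr1 s)"
    using Prod_intro[OF Arr_form[OF P Q] Arr_form[OF Q P] f g] by simp
  from Sig_intro[OF e(1) small_rosolini_body_form[OF P] this]
  show ?thesis unfolding small_rosolini_def by blast
qed

text \<open>Propositional extensionality turns the equivalence back into an identity. Its two
  propositionhood premises are \<open>h\<close> and the second component of the element of
  \<open>Nat_inf\<close>.\<close>

lemma rosoliniStructure_of_small:
  assumes P: "\<Gamma> \<turnstile> P : U i" and h: "\<Gamma> \<turnstile> h : isProp P" and r: "\<Gamma> \<turnstile> r : small_rosolini P"
  shows "\<exists>t. \<Gamma> \<turnstile> t : App (rosoliniStructure i) P"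
proof -
  have u: "\<Gamma> \<turnstile> Pr1 r : Nat_inf" using r unfolding small_rosolini_def by (rule Sig_elim1)
  have fg: "\<Gamma> \<turnstile> Pr2 r : (P \<rightarrowtriangle> angle (Pr1 (Pr1 r))) \<otimes> (angle (Pr1 (Pr1 r)) \<rightarrowtriangle> P)"
    using Sig_elim2[OF r[unfolded small_rosolini_def]] by simp
  note eu = Nat_inf_elim[OF u]
  note Q = angle_form[OF eu(1), of i]
  note q = PropExt_typing[OF P Q h eu(2) Prod_elim1[OF fg] Prod_elim2[OF fg]]
  have "\<exists>t. \<Gamma> \<turnstile> t : Sig Nat_inf (rosolini_body i P)"
    using Sig_intro[OF u rosolini_body_form[OF P], OF _] q by fastforce
  then show ?thesis using conv[OF _ eq_sym[OF rosoliniStructure_App[OF P]]] by blast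
qed

text \<open>Lowers the level before choice is applied, by mapping the structure to its small form
  inside a single truncation.\<close>

lemma small_trunc_of_isRosolini:
  assumes P: "\<Gamma> \<turnstile> P : U i" and s: "\<Gamma> \<turnstile> s : App (isRosolini i) P"
  shows "\<exists>t. \<Gamma> \<turnstile> t : Trunc (small_rosolini P)"
proof -
  have R: "\<Gamma> \<turnstile> App (rosoliniStructure i) P : U (Suc i)"
    by (rule Arr_elim[OF rosoliniStructure_typing[OF typing_ctx(1)[OF P]] P])
  note c = ctx_cons[OF R]
  let ?G = "App (rosoliniStructure i) P # \<Gamma>"
  have P1: "?G \<turnstile> P \<up> Suc 0 : U i" using weaken1[OF P c] by simp
  have "?G \<turnstile> Var 0 : App (rosoliniStructure i) (P \<up> Suc 0)" by (rule var_at[OF c]) simp_all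
  from small_of_rosoliniStructure[OF P1 this] obtain t where "?G \<turnstile> t : small_rosolini P \<up> Suc 0" by auto
  from trunc_map[OF R small_rosolini_form[OF P] this conv[OF s isRosolini_App[OF P]]] show ?thesis .
qed

section \<open>Factorisation through Rosolini partial functions\<close>

lemma lift_factors_through_Rosolini [simp]:
  "lift n k (factors_through_Rosolini i X Y f) = factors_through_Rosolini i (lift n k X) (lift n k Y) (lift n k f)"
  by (simp add: factors_through_Rosolini_def)

lemma Rosolini_tame_Id_form:
  assumes X: "\<Gamma> \<turnstile> X : U (Suc i)" and Y: "\<Gamma> \<turnstile> Y : U i" and f: "\<Gamma> \<turnstile> f : X \<rightarrowtriangle> Lift i Y"
  shows "X \<rightarrowtriangle> LiftD i (isRosolini i) Y # \<Gamma> \<turnstile>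
    Id ((X \<rightarrowtriangle> Lift i Y) \<up> 1) (f \<up> 1) (tame (isRosolini_isProp i) (Var 0)) : U (Suc i)"
proof -
  note c = typing_ctx(1)[OF X]
  show ?thesis using tame_Id_form(2)[OF X Y isRosolini_typing[OF c] isRosolini_isProp_typing[OF c] f] by simp
qed

lemma factors_through_Rosolini_form:
  assumes X: "\<Gamma> \<turnstile> X : U (Suc i)" and Y: "\<Gamma> \<turnstile> Y : U i" and f: "\<Gamma> \<turnstile> f : X \<rightarrowtriangle> Lift i Y"
  shows "\<Gamma> \<turnstile> factors_through_Rosolini i X Y f : U (Suc i)"
  unfolding factors_through_Rosolini_def
  using Arr_LiftD_form[OF X Y isRosolini_typing[OF typing_ctx(1)[OF X]]]
  by (intro Sig_form Rosolini_tame_Id_form[OF X Y f]) simp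

text \<open>The untruncated conclusion is reached through the intermediate statement that every
  extent is Rosolini. Being a proposition, it absorbs the truncation of \<open>disciplined\<close>;
  being structure for \<open>isRosolini\<close>, it yields the factorisation by
  \<open>tame_section\<close>.\<close>

lemma disciplined_imp_factors:
  assumes X: "\<Gamma> \<turnstile> X : U (Suc i)" and Y: "\<Gamma> \<turnstile> Y : U i" and f: "\<Gamma> \<turnstile> f : X \<rightarrowtriangle> Lift i Y"
    and s: "\<Gamma> \<turnstile> s : disciplined i (rosoliniStructure i) rosoliniStructure_isProp X Y f"
  shows "\<exists>t. \<Gamma> \<turnstile> t : factors_through_Rosolini i X Y f"
proof -
  note c = typing_ctx(1)[OF X]
  note R = rosoliniStructure_typing[OF c, of i] and R' = isRosolini_typing[OF c, of i]
    and m' = isRosolini_isProp_typing[OF c, of i]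
  let ?P = "Pr1 (App (f \<up> Suc 0) (Var 0))"
  obtain h where h: "\<Gamma> \<turnstile> h : Pi X (Trunc (App (rosoliniStructure i) ?P))"
    using disciplined_imp_trunc[OF X X Y R rosoliniStructure_isProp_typing[OF c] f s] by auto
  \<comment> \<open>By beta, \<open>isRosolini\<close> is the truncated Rosolini structure, so
    \<open>h\<close> only needs a conversion.\<close>
  have "\<Gamma> \<turnstile> h : pointwise (isRosolini i) X f"
    using conv[OF h Pi_cong[OF eq_refl[OF X] eq_sym[OF isRosolini_App[OF defined_form(2)[OF X f R]]]]] by simp
  from tame_section[OF X Y R' m' f this] obtain g p
    where g: "\<Gamma> \<turnstile> g : X \<rightarrowtriangle> LiftD i (isRosolini i) Y"
      and p: "\<Gamma> \<turnstile> p : Id (X \<rightarrowtriangle> Lift i Y) (tame (isRosolini_isProp i) g) f" by blast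
  \<comment> \<open>A factorisation asks for a path starting at \<open>f\<close>, the reverse of the
    one just obtained.\<close>
  have "\<Gamma> \<turnstile> path_sym (X \<rightarrowtriangle> Lift i Y) (tame (isRosolini_isProp i) g) p :
      Id (X \<rightarrowtriangle> Lift i Y) f (tame (isRosolini_isProp i) g)"
    by (rule path_sym_typing[OF Arr_form[OF X Lift_form[OF Y]] tame_typing(1)[OF X Y m' g] f p])
  then have "\<Gamma> \<turnstile> path_sym (X \<rightarrowtriangle> Lift i Y) (tame (isRosolini_isProp i) g) p :
      inst (Id ((X \<rightarrowtriangle> Lift i Y) \<up> 1) (f \<up> 1) (tame (isRosolini_isProp i) (Var 0))) g" by simp
  from Sig_intro[OF g Rosolini_tame_Id_form[OF X Y f] this]
  show ?thesis unfolding factors_through_Rosolini_def by blast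
qed

lemma factors_imp_pointwise:
  assumes X: "\<Gamma> \<turnstile> X : U (Suc i)" and Y: "\<Gamma> \<turnstile> Y : U i" and f: "\<Gamma> \<turnstile> f : X \<rightarrowtriangle> Lift i Y"
    and s: "\<Gamma> \<turnstile> s : factors_through_Rosolini i X Y f"
  shows "\<exists>h. \<Gamma> \<turnstile> h : pointwise (isRosolini i) X f"
proof -
  note c = typing_ctx(1)[OF X]
  note R = isRosolini_typing[OF c, of i] and m = isRosolini_isProp_typing[OF c, of i]
  note s' = s[unfolded factors_through_Rosolini_def]
  note g = Sig_elim1[OF s']
  have p: "\<Gamma> \<turnstile> Pr2 s : Id (X \<rightarrowtriangle> Lift i Y) f (tame (isRosolini_isProp i) (Pr1 s))"
    using Sig_elim2[OF s'] by simp
  show ?thesis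
    by (rule pointwise_of_tame[OF X Y R m f g
      path_sym_typing[OF Arr_form[OF X Lift_form[OF Y]] f tame_typing(1)[OF X Y m g] p]])
qed

text \<open>A detour around the level of \<open>rosoliniStructure\<close>: the extents are given
  small structure below their truncations, choice is applied in \<open>U i\<close>, and the small
  structures are converted back below the one outer truncation.\<close>

lemma trunc_rosoliniStructure:
  assumes cc: "\<Gamma> \<turnstile> c : countable_choice i" and f: "\<Gamma> \<turnstile> f : Nat \<rightarrowtriangle> Lift i Y"
    and h: "\<Gamma> \<turnstile> h : pointwise (isRosolini i) Nat f"
  shows "\<exists>a. \<Gamma> \<turnstile> a : Trunc (pointwise (rosoliniStructure i) Nat f)"
proof -
  note c = typing_ctx(1)[OF cc]
  note N = Nat_typing[OF c]
  note R = rosoliniStructure_typing[OF c, of i]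
  let ?P = "Pr1 (App (f \<up> Suc 0) (Var 0))" let ?S = "Pi Nat (small_rosolini ?P)"
  note P = defined_form(2)[OF N f R]
  have "Nat # \<Gamma> \<turnstile> App (h \<up> Suc 0) (Var 0) : App (isRosolini i) ?P"
    using App_weaken_Var0[OF N h] by simp
  from small_trunc_of_isRosolini[OF P this] obtain t where "Nat # \<Gamma> \<turnstile> t : Trunc (small_rosolini ?P)" by blast
  from countable_choice_elim[OF cc small_rosolini_form[OF P] Pi_intro[OF this]]
  obtain a where a: "\<Gamma> \<turnstile> a : Trunc ?S" by blast
  have S: "\<Gamma> \<turnstile> ?S : U i" by (rule Pi_form[OF N small_rosolini_form[OF P]])
  have Q: "\<Gamma> \<turnstile> pointwise (rosoliniStructure i) Nat f : U (Suc i)"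
    by (rule Pi_form[OF N defined_form(3)[OF N f R]])
  let ?G = "?S # \<Gamma>"
  note c1 = ctx_cons[OF S]
  note N1 = Nat_typing[OF c1]
  have f1: "?G \<turnstile> f \<up> Suc 0 : Nat \<rightarrowtriangle> Lift i (Y \<up> Suc 0)" using weaken1[OF f c1] by simp
  let ?l = "App (f \<up> Suc (Suc 0)) (Var 0)"
  have l: "Nat # ?G \<turnstile> ?l : Lift i (Y \<up> Suc (Suc 0))" using Arr_weaken_Var0[OF N1 f1] by simp
  have v: "?G \<turnstile> Var 0 : Pi Nat (small_rosolini (Pr1 ?l))" by (rule var_at[OF c1]) simp_all
  \<comment> \<open>\<open>f\<close> itself certifies that its extents are propositions, which
    propositional extensionality requires when leaving the small form.\<close>
  have p: "Nat # ?G \<turnstile> Pr1 (Pr2 ?l) : isProp (Pr1 ?l)"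
    using partials_elim(3)[OF l[unfolded Lift_partials]] by simp
  from rosoliniStructure_of_small[OF partials_elim(1)[OF l[unfolded Lift_partials]] p App_weaken_Var0[OF N1 v]]
  obtain r where "Nat # ?G \<turnstile> r : App (rosoliniStructure i) (Pr1 ?l)" by blast
  then have "?G \<turnstile> Lam r : pointwise (rosoliniStructure i) Nat f \<up> Suc 0"
    by (simp add: Pi_intro)
  from trunc_map[OF S Q this a] show ?thesis .
qed

lemma disciplined_iff_factors:
  assumes cc: "\<Gamma> \<turnstile> c : countable_choice i" and f: "\<Gamma> \<turnstile> f : Nat \<rightarrowtriangle> Lift i Nat"
  shows "\<exists>t. \<Gamma> \<turnstile> t : disciplined i (rosoliniStructure i) rosoliniStructure_isProp Nat Nat f
    \<leftrightharpoons> factors_through_Rosolini i Nat Nat f"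
proof -
  note c = typing_ctx(1)[OF cc]
  note N = Nat_typing[OF c]
  let ?A = "disciplined i (rosoliniStructure i) rosoliniStructure_isProp Nat Nat f"
  let ?B = "factors_through_Rosolini i Nat Nat f"
  have A: "\<Gamma> \<turnstile> ?A : U (Suc i)"
    using disciplined_form(2)[OF N N rosoliniStructure_typing[OF c] rosoliniStructure_isProp_typing[OF c] f] by simp
  have B: "\<Gamma> \<turnstile> ?B : U (Suc i)" by (rule factors_through_Rosolini_form[OF N N f])
  note cA = ctx_cons[OF A] and cB = ctx_cons[OF B]
  note NA = Nat_typing[OF cA] and NB = Nat_typing[OF cB]
  have fA: "?A # \<Gamma> \<turnstile> f \<up> Suc 0 : Nat \<rightarrowtriangle> Lift i Nat" using weaken1[OF f cA] by simp
  have "?A # \<Gamma> \<turnstile> Var 0 : disciplined i (rosoliniStructure i) rosoliniStructure_isProp Nat Nat (f \<up> Suc 0)"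
    by (rule var_at[OF cA]) simp_all
  from disciplined_imp_factors[OF NA NA fA this] obtain h where "?A # \<Gamma> \<turnstile> h : ?B \<up> Suc 0" by auto
  then have h: "\<Gamma> \<turnstile> Lam h : ?A \<rightarrowtriangle> ?B" by (rule Arr_intro)
  have fB: "?B # \<Gamma> \<turnstile> f \<up> Suc 0 : Nat \<rightarrowtriangle> Lift i Nat" using weaken1[OF f cB] by simp
  have ccB: "?B # \<Gamma> \<turnstile> c \<up> Suc 0 : countable_choice i" using weaken1[OF cc cB] by simp
  have "?B # \<Gamma> \<turnstile> Var 0 : factors_through_Rosolini i Nat Nat (f \<up> Suc 0)"
    by (rule var_at[OF cB]) simp_all
  from factors_imp_pointwise[OF NB NB fB this]
  obtain q where "?B # \<Gamma> \<turnstile> q : pointwise (isRosolini i) Nat (f \<up> Suc 0)" by blast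
  from trunc_rosoliniStructure[OF ccB fB this]
  obtain a where "?B # \<Gamma> \<turnstile> a : Trunc (pointwise (rosoliniStructure i) Nat (f \<up> Suc 0))" by blast
  from disciplined_of_trunc[OF NB NB rosoliniStructure_typing[OF cB] rosoliniStructure_isProp_typing[OF cB] fB this]
  obtain k where "?B # \<Gamma> \<turnstile> k : ?A \<up> Suc 0" by auto
  then have "\<Gamma> \<turnstile> Lam k : ?B \<rightarrowtriangle> ?A" by (rule Arr_intro)
  from Iff_intro[OF A B h this] show ?thesis by blast
qed

theorem theorem5p46:
  shows
    "(\<forall>i j. \<exists>t. [] \<turnstile> t :
        Pi (U i \<rightarrowtriangle> U j) (Pi (structural_dominance i (Var 0))
          (countable_choice j \<rightarrowtriangle>
            Pi (Nat \<rightarrowtriangle> Lift i Nat)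
              (disciplined i (Var 2) (Pr1 (Var 1)) Nat Nat (Var 0)
                \<leftrightharpoons> Pi Nat (Trunc (App (Var 3) (defined (App (Var 1) (Var 0)))))))))
     \<and>
     (\<forall>i. \<exists>t. [] \<turnstile> t :
        countable_choice i \<rightarrowtriangle>
          Pi (Nat \<rightarrowtriangle> Lift i Nat)
            (disciplined i (rosoliniStructure i) (rosoliniStructure_isProp) Nat Nat (Var 0)
              \<leftrightharpoons> factors_through_Rosolini i Nat Nat (Var 0)))"
proof (intro conjI allI)
  fix i j
  let ?G1 = "[U i \<rightarrowtriangle> U j]" let ?G2 = "structural_dominance i (Var 0) # ?G1"
  let ?G3 = "countable_choice j # ?G2" let ?G4 = "(Nat \<rightarrowtriangle> Lift i Nat) # ?G3"
  note N = Nat_typing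
  have "[] \<turnstile> U i \<rightarrowtriangle> U j : U (Suc (max i j))"
    by (intro Arr_form cumul_le[OF univ[OF ctx_nil]]) auto
  note c1 = ctx_cons[OF this]
  have v1: "?G1 \<turnstile> Var 0 : U i \<rightarrowtriangle> U j" by (rule var_at[OF c1]) simp_all
  note c2 = ctx_cons[OF structural_dominance_form[OF v1]]
  note c3 = ctx_cons[OF countable_choice_form[OF c2]]
  note c4 = ctx_cons[OF Arr_form[OF N[OF c3] Lift_form[OF N[OF c3]]]]
  \<comment> \<open>Over \<open>?G4\<close> the operation, the dominance, choice and the partial
    function are \<open>Var 3\<close>, \<open>Var 2\<close>, \<open>Var 1\<close> and
    \<open>Var 0\<close>; the first component of the dominance is the map to
    propositionhood.\<close>
  have D: "?G4 \<turnstile> Var 3 : U i \<rightarrowtriangle> U j" by (rule var_at[OF c4]) (simp_all add: eval_nat_numeral)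
  have "?G4 \<turnstile> Var 2 : structural_dominance i (Var 0) \<up> 3" by (rule var_at[OF c4]) (simp_all add: eval_nat_numeral)
  then have m: "?G4 \<turnstile> Pr1 (Var 2) : propositional i (Var 3)"
    by (intro Prod_elim1) (simp add: structural_dominance_def propositional_def eval_nat_numeral)
  have cc: "?G4 \<turnstile> Var 1 : countable_choice j" by (rule var_at[OF c4]) simp_all
  have f: "?G4 \<turnstile> Var 0 : Nat \<rightarrowtriangle> Lift i Nat" by (rule var_at[OF c4]) simp_all
  from disciplined_iff_trunc[OF D m f cc]
  obtain t where "?G4 \<turnstile> t : disciplined i (Var 3) (Pr1 (Var 2)) Nat Nat (Var 0) \<leftrightharpoons>
      Pi Nat (Trunc (App (Var 4) (Pr1 (App (Var 1) (Var 0)))))" by (auto simp: eval_nat_numeral)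
  \<comment> \<open>In the theorem choice is the domain of a non-dependent arrow, so the type to its
    right does not count a variable for it. The weakening by one restores the indices over
    \<open>?G3\<close>.\<close>
  then have "?G3 \<turnstile> Lam t : Pi (Nat \<rightarrowtriangle> Lift i Nat)
              (disciplined i (Var 2) (Pr1 (Var 1)) Nat Nat (Var 0)
                \<leftrightharpoons> Pi Nat (Trunc (App (Var 3) (defined (App (Var 1) (Var 0)))))) \<up> Suc 0"
    by (simp add: eval_nat_numeral defined_def Pi_intro)
  then show "\<exists>t. [] \<turnstile> t :
        Pi (U i \<rightarrowtriangle> U j) (Pi (structural_dominance i (Var 0))
          (countable_choice j \<rightarrowtriangle>
            Pi (Nat \<rightarrowtriangle> Lift i Nat)
              (disciplined i (Var 2) (Pr1 (Var 1)) Nat Nat (Var 0)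
                \<leftrightharpoons> Pi Nat (Trunc (App (Var 3) (defined (App (Var 1) (Var 0))))))))"
    by (blast intro: Pi_intro Arr_intro)
next
  fix i
  let ?G1 = "[countable_choice i]" let ?G2 = "(Nat \<rightarrowtriangle> Lift i Nat) # ?G1"
  note N = Nat_typing
  note c1 = ctx_cons[OF countable_choice_form[OF ctx_nil]]
  note c2 = ctx_cons[OF Arr_form[OF N[OF c1] Lift_form[OF N[OF c1]]]]
  have cc: "?G2 \<turnstile> Var 1 : countable_choice i" by (rule var_at[OF c2]) simp_all
  have f: "?G2 \<turnstile> Var 0 : Nat \<rightarrowtriangle> Lift i Nat" by (rule var_at[OF c2]) simp_all
  from disciplined_iff_factors[OF cc f]
  obtain t where "?G2 \<turnstile> t : disciplined i (rosoliniStructure i) rosoliniStructure_isProp Nat Nat (Var 0)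
      \<leftrightharpoons> factors_through_Rosolini i Nat Nat (Var 0)" by blast
  then have "?G1 \<turnstile> Lam t : Pi (Nat \<rightarrowtriangle> Lift i Nat)
      (disciplined i (rosoliniStructure i) rosoliniStructure_isProp Nat Nat (Var 0)
        \<leftrightharpoons> factors_through_Rosolini i Nat Nat (Var 0)) \<up> Suc 0"
    by (simp add: Pi_intro)
  then show "\<exists>t. [] \<turnstile> t : countable_choice i \<rightarrowtriangle> Pi (Nat \<rightarrowtriangle> Lift i Nat)
      (disciplined i (rosoliniStructure i) rosoliniStructure_isProp Nat Nat (Var 0)
        \<leftrightharpoons> factors_through_Rosolini i Nat Nat (Var 0))"
    by (blast intro: Arr_intro)
qed

end
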